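(* Thompson's group $F$ has one end.
   Context: Thompson's group $F$ is the finitely presented, torsion-free group of orientation-preserving piecewise-linear homeomorphisms of the unit interval $[0,1]$ with finitely many breakpoints, all at dyadic rationals, and all slopes powers of $2$; it has the infinite presentation $F=\langle x_0,x_1,x_2,\ldots\mid x_{j+1}=x_ix_jx_i^{-1},\ i<j\rangle$. One end: a finitely generated infinite group $G$ has one end if for some (equivalently every) finite generating set $T$, for every $n$ the complement in the Cayley graph ${\rm Cay}(G,T)$ of the ball of radius $n$ about the identity has exactly one unbounded connected component. *)

theory Defs
  imports "HOL-Analysis.Analysis" "HOL-Algebra.Bij" "HOL-Algebra.Generated_Groups"
begin

section \<open>Thompson's group F\<close>

text \<open>
  The set \<open>B\<close> contains all the breakpoints. The condition also speaks about pieces \<open>{a..b}\<close>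
  whose endpoints lie in \<open>B\<close>, since only the open interval has to avoid \<open>B\<close>. The library's
  \<open>dyadics\<close> are the nonnegative dyadic rationals, which are all those that matter in \<open>{0..1}\<close>.
\<close>

definition dyadic_piecewise_linear :: "(real \<Rightarrow> real) \<Rightarrow> bool" where
  "dyadic_piecewise_linear f \<longleftrightarrow>
     (\<exists>B. finite B \<and> B \<subseteq> dyadics \<inter> {0..1} \<and>
        (\<forall>a b. 0 \<le> a \<and> a < b \<and> b \<le> 1 \<and> {a<..<b} \<inter> B = {} \<longrightarrow>
           (\<exists>(k::int) c. \<forall>x\<in>{a..b}. f x = 2 powi k * x + c)))"

text \<open>
  Self-maps of the unit interval are represented by functions that are \<open>undefined\<close> outside
  \<open>{0..1}\<close>, as in \<^const>\<open>BijGroup\<close>, so that equality is equality on \<open>{0..1}\<close>.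
\<close>

definition thompson_F_maps :: "(real \<Rightarrow> real) set" where
  "thompson_F_maps =
     {f \<in> extensional {0..1}.
        (\<exists>g. homeomorphism {0..1} {0..1} f g) \<and>
        strict_mono_on {0..1} f \<and>
        dyadic_piecewise_linear f}"

definition thompson_F :: "(real \<Rightarrow> real) monoid" where
  "thompson_F = (BijGroup {0..1}) \<lparr>carrier := thompson_F_maps\<rparr>"


section \<open>Cayley graphs and one-endedness\<close>

text \<open>
  The Cayley graph is undirected, and is given by its vertex set \<open>carrier G\<close> and its symmetric
  adjacency relation.
\<close>

definition cayley_adj :: "('a, 'm) monoid_scheme \<Rightarrow> 'a set \<Rightarrow> 'a rel" where
  "cayley_adj G T =
     {(g, h). g \<in> carrier G \<and> h \<in> carrier G \<and>
        (\<exists>t\<in>T. h = g \<otimes>\<^bsub>G\<^esub> t \<or> g = h \<otimes>\<^bsub>G\<^esub> t)}"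

definition cayley_ball :: "('a, 'm) monoid_scheme \<Rightarrow> 'a set \<Rightarrow> nat \<Rightarrow> 'a set" where
  "cayley_ball G T n =
     {g \<in> carrier G. \<exists>k\<le>n. (\<one>\<^bsub>G\<^esub>, g) \<in> cayley_adj G T ^^ k}"

definition induced_components :: "'a rel \<Rightarrow> 'a set \<Rightarrow> 'a set set" where
  "induced_components E X = X // ((E \<inter> X \<times> X)\<^sup>* \<inter> X \<times> X)"

definition cayley_unbounded :: "('a, 'm) monoid_scheme \<Rightarrow> 'a set \<Rightarrow> 'a set \<Rightarrow> bool" where
  "cayley_unbounded G T C \<longleftrightarrow> (\<forall>r. \<not> C \<subseteq> cayley_ball G T r)"

definition has_one_end :: "('a, 'm) monoid_scheme \<Rightarrow> bool" where
  "has_one_end G \<longleftrightarrow>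
     group G \<and> infinite (carrier G) \<and>
     (\<exists>T. finite T \<and> T \<subseteq> carrier G \<and> generate G T = carrier G \<and>
        (\<forall>n. \<exists>!C. C \<in> induced_components (cayley_adj G T) (carrier G - cayley_ball G T n) \<and>
                  cayley_unbounded G T C))"

end

theory Submission
  imports Defs "HOL-Algebra.Multiplicative_Group"
begin

text \<open>
  A group is one-ended as soon as it has a finite generating set \<open>T\<close> whose elements are linked by
  chains in which neighbours \<open>s, t\<close> generate a copy of \<open>\<int>\<^sup>2\<close>. Indeed, only finitely many of the
  lines \<open>g s\<^sup>i\<langle>t\<rangle>\<close> and \<open>g t\<^sup>j\<langle>s\<rangle>\<close> of the plane \<open>g\<langle>s, t\<rangle>\<close> meet a given ball, so all rays of the
  plane lead to the same component of the complement; the line \<open>g\<langle>t\<rangle>\<close> is shared with the next plane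
  at \<open>g\<close> and with the planes at \<open>g t\<close>, which gives one component for all \<open>g\<close>. A point with no ray
  that avoids the ball lies between two points of the ball on its line, so there are finitely many.

  In \<open>F\<close>, two nontrivial elements with disjoint supports generate \<open>\<int>\<^sup>2\<close>, because \<open>F\<close> is torsion-free.
  The generators \<open>x\<^sub>0, x\<^sub>1\<close> agree near one end point, so \<open>x\<^sub>1\<close> and \<open>w = x\<^sub>1\<inverse>x\<^sub>0\<close> generate \<open>F\<close> and each
  fixes an interval; \<open>a = x\<^sub>0\<inverse>w x\<^sub>0\<close> and \<open>x\<^sub>2\<close> complete the chain \<open>x\<^sub>1, a, x\<^sub>2, w\<close>.

  That \<open>x\<^sub>0, x\<^sub>1\<close> generate \<open>F\<close>: products of the \<open>x\<^sub>i\<close> carry every partition of \<open>[0, 1]\<close> into standard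
  dyadic intervals to the partition by powers of \<open>1/2\<close> with the same number of parts, and every
  element of \<open>F\<close> carries some standard dyadic partition to another one.
\<close>

section \<open>One-endedness from commuting generators\<close>

text \<open>The closure relates a vertex of the ball to itself only. Reflexivity and transitivity
  thus hold unconditionally, and intersecting with \<open>X \<times> X\<close> later gives the
  relation whose classes are the components.\<close>

definition outside_conn :: "('a, 'm) monoid_scheme \<Rightarrow> 'a set \<Rightarrow> nat \<Rightarrow> 'a rel" where
  "outside_conn G T n =
     (let X = carrier G - cayley_ball G T n in (cayley_adj G T \<inter> X \<times> X)\<^sup>*)"

text \<open>For commuting \<open>s\<close> and \<open>t\<close> the second clause says that
  \<open>(i, j) \<mapsto> s^i t^j\<close> embeds \<open>Z^2\<close> in the group.\<close>

definition independent :: "('a, 'm) monoid_scheme \<Rightarrow> 'a \<Rightarrow> 'a \<Rightarrow> bool" where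
  "independent G s t \<longleftrightarrow> s \<otimes>\<^bsub>G\<^esub> t = t \<otimes>\<^bsub>G\<^esub> s \<and>
     (\<forall>(i::int) (j::int). s [^]\<^bsub>G\<^esub> i \<otimes>\<^bsub>G\<^esub> t [^]\<^bsub>G\<^esub> j = \<one>\<^bsub>G\<^esub> \<longrightarrow> i = 0 \<and> j = 0)"

text \<open>The bounds on \<open>\<bar>i\<bar>\<close> and \<open>\<bar>j\<bar>\<close> cover both
  rays of each line at once. Relating a line to itself therefore says that its two rays lead to one
  component, which already fails for the integers with generator 1; reflexivity has to be proved
  where it is used.\<close>

definition same_end ::
  "('a, 'm) monoid_scheme \<Rightarrow> 'a set \<Rightarrow> nat \<Rightarrow> 'a \<Rightarrow> 'a \<Rightarrow> 'a \<Rightarrow> 'a \<Rightarrow> bool" where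
  "same_end G T n g s h t \<longleftrightarrow>
     (\<exists>K::int. \<forall>i j. K \<le> \<bar>i\<bar> \<longrightarrow> K \<le> \<bar>j\<bar> \<longrightarrow>
        (g \<otimes>\<^bsub>G\<^esub> s [^]\<^bsub>G\<^esub> i, h \<otimes>\<^bsub>G\<^esub> t [^]\<^bsub>G\<^esub> j) \<in> outside_conn G T n)"

lemma sym_cayley_adj: "sym (cayley_adj G T)"
  by (auto simp: sym_def cayley_adj_def)

lemma sym_outside_conn: "sym (outside_conn G T n)"
  unfolding outside_conn_def Let_def
  by (intro sym_rtrancl sym_Int sym_cayley_adj) (auto simp: sym_def)

lemma outside_conn_trans:
  "(x, y) \<in> outside_conn G T n \<Longrightarrow> (y, z) \<in> outside_conn G T n \<Longrightarrow> (x, z) \<in> outside_conn G T n"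
  unfolding outside_conn_def Let_def by (rule rtrancl_trans)

lemma trans_outside_conn: "trans (outside_conn G T n)"
  by (blast intro: transI outside_conn_trans)

lemma outside_conn_refl: "(x, x) \<in> outside_conn G T n"
  by (simp add: outside_conn_def Let_def)

lemma same_end_sym: "same_end G T n g s h t \<Longrightarrow> same_end G T n h t g s"
  unfolding same_end_def by (meson sym_outside_conn symD)

lemma same_end_trans:
  assumes "same_end G T n g s h t" "same_end G T n h t k u"
  shows "same_end G T n g s k u"
proof -
  obtain K where K: "\<And>i j. K \<le> \<bar>i\<bar> \<Longrightarrow> K \<le> \<bar>j\<bar> \<Longrightarrow>
        (g \<otimes>\<^bsub>G\<^esub> s [^]\<^bsub>G\<^esub> i, h \<otimes>\<^bsub>G\<^esub> t [^]\<^bsub>G\<^esub> (j::int)) \<in> outside_conn G T n"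
    using assms(1) unfolding same_end_def by blast
  obtain L where L: "\<And>i j. L \<le> \<bar>i\<bar> \<Longrightarrow> L \<le> \<bar>j\<bar> \<Longrightarrow>
        (h \<otimes>\<^bsub>G\<^esub> t [^]\<^bsub>G\<^esub> i, k \<otimes>\<^bsub>G\<^esub> u [^]\<^bsub>G\<^esub> (j::int)) \<in> outside_conn G T n"
    using assms(2) unfolding same_end_def by blast
  show ?thesis unfolding same_end_def
  proof (intro exI allI impI)
    \<comment> \<open>The detour goes through the point of the middle line with exponent
      \<open>\<bar>K\<bar> + \<bar>L\<bar>\<close>, which is far enough out for both
      hypotheses.\<close>
    fix i j :: int assume "\<bar>K\<bar> + \<bar>L\<bar> \<le> \<bar>i\<bar>" "\<bar>K\<bar> + \<bar>L\<bar> \<le> \<bar>j\<bar>"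
    then show "(g \<otimes>\<^bsub>G\<^esub> s [^]\<^bsub>G\<^esub> i, k \<otimes>\<^bsub>G\<^esub> u [^]\<^bsub>G\<^esub> j) \<in> outside_conn G T n"
      by (intro outside_conn_trans[OF K[of i "\<bar>K\<bar> + \<bar>L\<bar>"] L[of "\<bar>K\<bar> + \<bar>L\<bar>" j]]) auto
  qed
qed

section \<open>Balls and paths in the Cayley graph\<close>

context group
begin

lemma cayley_adj_mult:
  "T \<subseteq> carrier G \<Longrightarrow> g \<in> carrier G \<Longrightarrow> t \<in> T \<Longrightarrow> (g, g \<otimes> t) \<in> cayley_adj G T"
  by (auto simp: cayley_adj_def)

text \<open>The graph is locally finite, since a neighbour of \<open>g\<close> is
  \<open>g \<otimes> t\<close> or \<open>g \<otimes> inv t\<close>; hence only finitely many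
  vertices end a path of length \<open>k\<close> from the identity.\<close>

lemma finite_cayley_ball:
  assumes "finite T" "T \<subseteq> carrier G"
  shows "finite (cayley_ball G T n)"
proof -
  have step: "finite (cayley_adj G T `` {g})" for g
  proof (rule finite_subset)
    show "cayley_adj G T `` {g} \<subseteq> (\<lambda>t. g \<otimes> t) ` T \<union> (\<lambda>t. g \<otimes> inv t) ` T"
    proof
      fix h assume "h \<in> cayley_adj G T `` {g}"
      then obtain t where "g \<in> carrier G" "h \<in> carrier G" "t \<in> T" "h = g \<otimes> t \<or> g = h \<otimes> t"
        by (auto simp: cayley_adj_def)
      moreover have "h = h \<otimes> t \<otimes> inv t"
        using calculation assms(2) by (metis inv_solve_right m_closed subsetD)
      ultimately show "h \<in> (\<lambda>t. g \<otimes> t) ` T \<union> (\<lambda>t. g \<otimes> inv t) ` T"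
        by blast
    qed
  qed (use assms in auto)
  have "finite ((cayley_adj G T ^^ k) `` {\<one>})" for k
  proof (induction k)
    case (Suc k)
    have "(cayley_adj G T ^^ Suc k) `` {\<one>}
        = (\<Union>g\<in>(cayley_adj G T ^^ k) `` {\<one>}. cayley_adj G T `` {g})"
      by auto
    then show ?case using Suc step by simp
  qed auto
  then have "finite (\<Union>k\<le>n. (cayley_adj G T ^^ k) `` {\<one>})" by simp
  then show ?thesis
    by (rule rev_finite_subset) (auto simp: cayley_ball_def)
qed

text \<open>Edges are right multiplications, so a word for \<open>h\<close> can be read as a path
  from any start. The start stays arbitrary in the induction, because the path of \<open>h2\<close>
  begins at \<open>g \<otimes> h1\<close>; an inverse generator is an edge walked backwards.\<close>

lemma generate_imp_cayley_path:
  assumes T: "T \<subseteq> carrier G" and "h \<in> generate G T"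
  shows "g \<in> carrier G \<Longrightarrow> (g, g \<otimes> h) \<in> (cayley_adj G T)\<^sup>*"
  using assms(2)
proof (induction arbitrary: g rule: generate.induct)
  case (incl h)
  then show ?case using cayley_adj_mult[OF T] by blast
next
  case (inv h)
  then have "(g \<otimes> inv h, g \<otimes> inv h \<otimes> h) \<in> cayley_adj G T"
    using cayley_adj_mult[OF T] T by (meson inv_closed m_closed subsetD)
  moreover have "g \<otimes> inv h \<otimes> h = g"
    using inv T by (simp add: m_assoc subsetD)
  ultimately show ?case by (metis sym_cayley_adj symD r_into_rtrancl)
next
  case (eng h1 h2)
  then have h: "h1 \<in> carrier G" "h2 \<in> carrier G"
    using generate_in_carrier[OF T] by auto
  then have "(g, g \<otimes> h1) \<in> (cayley_adj G T)\<^sup>*"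
    and "(g \<otimes> h1, g \<otimes> h1 \<otimes> h2) \<in> (cayley_adj G T)\<^sup>*"
    using eng by simp_all
  then show ?case
    using h eng.prems by (simp add: m_assoc)
qed simp

text \<open>This turns finiteness into boundedness: a component inside a finite set is not
  unbounded.\<close>

lemma finite_subset_cayley_ball:
  assumes T: "T \<subseteq> carrier G" "generate G T = carrier G"
    and F: "finite F" "F \<subseteq> carrier G"
  shows "\<exists>r. F \<subseteq> cayley_ball G T r"
  using F
proof induction
  case (insert x F)
  then obtain r where r: "F \<subseteq> cayley_ball G T r" by auto
  have "(\<one>, \<one> \<otimes> x) \<in> (cayley_adj G T)\<^sup>*"
    using insert.prems T by (intro generate_imp_cayley_path) simp_all
  then have "(\<one>, x) \<in> (cayley_adj G T)\<^sup>*"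
    using insert.prems by simp
  then obtain k where "(\<one>, x) \<in> cayley_adj G T ^^ k"
    unfolding rtrancl_power by blast
  then have "x \<in> cayley_ball G T (max r k)"
    using insert.prems unfolding cayley_ball_def by (blast intro: max.cobounded2)
  moreover have "F \<subseteq> cayley_ball G T (max r k)"
    using r unfolding cayley_ball_def by (blast intro: max.coboundedI1)
  ultimately show ?case by auto
qed auto

section \<open>Powers and commuting elements\<close>

lemma int_pow_add:
  "s \<in> carrier G \<Longrightarrow> g \<in> carrier G \<Longrightarrow> g \<otimes> s [^] (i::int) \<otimes> s [^] (j::int) = g \<otimes> s [^] (i + j)"
  by (simp add: int_pow_mult m_assoc)

lemma int_pow_inject_of_torsion_free:
  assumes "s \<in> carrier G" "\<And>i::int. s [^] i = \<one> \<Longrightarrow> i = 0" "s [^] (i::int) = s [^] (j::int)"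
  shows "i = j"
proof -
  have "s [^] (i - j) = \<one>"
    using assms(1,3) by (simp add: int_pow_diff)
  then show ?thesis using assms(2) by force
qed

lemma commute_nat_pow:
  assumes "s \<in> carrier G" "t \<in> carrier G" "s \<otimes> t = t \<otimes> s"
  shows "s [^] (n::nat) \<otimes> t = t \<otimes> s [^] n"
proof (induction n)
  case (Suc n)
  have "s [^] Suc n \<otimes> t = s [^] n \<otimes> (t \<otimes> s)"
    using assms by (simp add: m_assoc)
  also have "\<dots> = t \<otimes> s [^] Suc n"
    using assms Suc by (simp add: m_assoc[symmetric])
  finally show ?case .
qed (use assms in auto)

lemma commute_inv:
  assumes "s \<in> carrier G" "t \<in> carrier G" "s \<otimes> t = t \<otimes> s"
  shows "inv s \<otimes> t = t \<otimes> inv s"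
proof -
  have "inv s \<otimes> t = inv s \<otimes> (t \<otimes> s) \<otimes> inv s"
    using assms(1,2) by (simp add: m_assoc)
  also have "\<dots> = inv s \<otimes> (s \<otimes> t) \<otimes> inv s"
    by (simp only: assms(3))
  also have "\<dots> = t \<otimes> inv s"
    using assms(1,2) by (simp add: m_assoc[symmetric])
  finally show ?thesis .
qed

lemma commute_int_pow_left:
  assumes "s \<in> carrier G" "t \<in> carrier G" "s \<otimes> t = t \<otimes> s"
  shows "s [^] (i::int) \<otimes> t = t \<otimes> s [^] i"
  using commute_nat_pow[OF assms] commute_inv[OF nat_pow_closed[OF assms(1)] assms(2) commute_nat_pow[OF assms]]
  unfolding int_pow_def2 by presburger

lemma commute_int_pow:
  assumes "s \<in> carrier G" "t \<in> carrier G" "s \<otimes> t = t \<otimes> s"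
  shows "s [^] (i::int) \<otimes> t [^] (j::int) = t [^] j \<otimes> s [^] i"
  using commute_int_pow_left[OF assms(2,1) assms(3)[symmetric], of j]
    commute_int_pow_left[OF assms(1) int_pow_closed[OF assms(2)], of j i]
  by argo

lemma independent_sym:
  assumes "s \<in> carrier G" "t \<in> carrier G" "independent G s t"
  shows "independent G t s"
proof -
  have "s [^] (i::int) \<otimes> t [^] (j::int) = t [^] j \<otimes> s [^] i" for i j
    using assms(3) by (intro commute_int_pow assms(1,2)) (simp add: independent_def)
  then show ?thesis using assms(3) unfolding independent_def by metis
qed

lemma independent_imp_torsion_free:
  assumes "s \<in> carrier G" "independent G s t" "s [^] (i::int) = \<one>"
  shows "i = 0"
proof -
  have "s [^] i \<otimes> t [^] (0::int) = \<one>" using assms by simp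
  then show ?thesis using assms(2) unfolding independent_def by blast
qed

section \<open>Lines and planes in the Cayley graph\<close>

lemma inj_independent:
  assumes s: "s \<in> carrier G" and t: "t \<in> carrier G" and g: "g \<in> carrier G"
    and ind: "independent G s t"
  shows "inj (\<lambda>(i::int, j::int). g \<otimes> s [^] i \<otimes> t [^] j)"
proof (rule injI, clarify)
  fix i j i' j' :: int
  assume "g \<otimes> s [^] i \<otimes> t [^] j = g \<otimes> s [^] i' \<otimes> t [^] j'"
  then have eq: "s [^] i \<otimes> t [^] j = s [^] i' \<otimes> t [^] j'"
    using s t g by (simp add: m_assoc)
  \<comment> \<open>The exponents are ordered so that the primed powers split off at the two outer
    sides of the product.\<close>
  have "s [^] (- i' + i) \<otimes> t [^] (j + - j') = inv (s [^] i') \<otimes> (s [^] i \<otimes> t [^] j) \<otimes> inv (t [^] j')"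
    using s t by (simp only: int_pow_mult int_pow_neg) (simp add: m_assoc)
  also have "\<dots> = \<one>"
    unfolding eq using s t by (simp add: m_assoc)
  finally show "i = i' \<and> j = j'"
    using ind unfolding independent_def by force
qed

lemma plane_leaves_finite:
  assumes "s \<in> carrier G" "t \<in> carrier G" "g \<in> carrier G" "independent G s t" "finite X"
  shows "\<exists>K::int. \<forall>i j. K \<le> \<bar>i\<bar> \<or> K \<le> \<bar>j\<bar> \<longrightarrow> g \<otimes> s [^] i \<otimes> t [^] j \<notin> X"
proof -
  define A where "A = (\<lambda>(i::int, j::int). g \<otimes> s [^] i \<otimes> t [^] j) -` X"
  have "finite A"
    unfolding A_def by (intro finite_vimageI assms(5) inj_independent assms(1-4))
  \<comment> \<open>The sum bounds each of its terms, and it makes sense also when \<open>A\<close>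
    is empty.\<close>
  define S where "S = (\<Sum>(i, j)\<in>A. \<bar>i\<bar> + \<bar>j\<bar>)"
  have S: "\<bar>i\<bar> + \<bar>j\<bar> \<le> S" if "(i, j) \<in> A" for i j
    using member_le_sum[of "(i, j)" A "\<lambda>(i, j). \<bar>i\<bar> + \<bar>j\<bar>"] that \<open>finite A\<close>
    unfolding S_def by auto
  show ?thesis
  proof (intro exI[of _ "S + 1"] allI impI notI)
    fix i j :: int
    assume "S + 1 \<le> \<bar>i\<bar> \<or> S + 1 \<le> \<bar>j\<bar>" "g \<otimes> s [^] i \<otimes> t [^] j \<in> X"
    moreover from this have "(i, j) \<in> A" unfolding A_def by simp
    ultimately show False using S[of i j] by linarith
  qed
qed

lemma line_outside_conn:
  assumes T: "T \<subseteq> carrier G" "s \<in> T" and g: "g \<in> carrier G" and "a \<le> (b::int)"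
    and "\<And>i. a \<le> i \<Longrightarrow> i \<le> b \<Longrightarrow> g \<otimes> s [^] i \<notin> cayley_ball G T n"
  shows "(g \<otimes> s [^] a, g \<otimes> s [^] b) \<in> outside_conn G T n"
  using assms(4,5)
proof (induction b rule: int_ge_induct)
  case base
  then show ?case by (simp add: outside_conn_refl)
next
  case (step b)
  have s: "s \<in> carrier G" using T by auto
  have "(g \<otimes> s [^] b, g \<otimes> s [^] b \<otimes> s) \<in> cayley_adj G T"
    using T g s by (intro cayley_adj_mult) auto
  moreover have "g \<otimes> s [^] b \<otimes> s = g \<otimes> s [^] (b + 1)"
    using int_pow_add[OF s g, of b 1] s by simp
  ultimately have "(g \<otimes> s [^] b, g \<otimes> s [^] (b + 1)) \<in> outside_conn G T n"
    unfolding outside_conn_def Let_def using step g s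
    by (intro r_into_rtrancl) auto
  then show ?case using step by (force intro: outside_conn_trans)
qed

lemma full_line_outside_conn:
  assumes "T \<subseteq> carrier G" "s \<in> T" "g \<in> carrier G"
    and "\<And>i::int. g \<otimes> s [^] i \<notin> cayley_ball G T n"
  shows "(g \<otimes> s [^] (a::int), g \<otimes> s [^] (b::int)) \<in> outside_conn G T n"
  using line_outside_conn[OF assms(1-3)] assms(4) sym_outside_conn
  by (metis linear symD)

text \<open>Far out, every line parallel to one of the two axes of the plane \<open>g\<langle>s, t\<rangle>\<close> misses the ball.\<close>

lemma same_end_independent:
  assumes T: "finite T" "T \<subseteq> carrier G" "s \<in> T" "t \<in> T" and g: "g \<in> carrier G"
    and ind: "independent G s t"
  shows "same_end G T n g s g t"
proof -
  have st: "s \<in> carrier G" "t \<in> carrier G" using T by auto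
  obtain K where K: "\<And>i j::int. K \<le> \<bar>i\<bar> \<or> K \<le> \<bar>j\<bar> \<Longrightarrow>
      g \<otimes> s [^] i \<otimes> t [^] j \<notin> cayley_ball G T n"
    using plane_leaves_finite[OF st g ind finite_cayley_ball[OF T(1,2)]] by blast
  have comm: "g \<otimes> s [^] (i::int) \<otimes> t [^] (j::int) = g \<otimes> t [^] j \<otimes> s [^] i" for i j
    using st g ind commute_int_pow[of s t] by (simp add: m_assoc independent_def)
  show ?thesis unfolding same_end_def
  proof (intro exI allI impI)
    fix i j :: int assume ij: "K \<le> \<bar>i\<bar>" "K \<le> \<bar>j\<bar>"
    \<comment> \<open>The walk first follows the line \<open>g s^i \<langle>t\<rangle>\<close> from
      \<open>g s^i\<close> to the corner \<open>g s^i t^j = g t^j s^i\<close>, then the line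
      \<open>g t^j \<langle>s\<rangle>\<close> to \<open>g t^j\<close>.\<close>
    have "(g \<otimes> s [^] i \<otimes> t [^] (0::int), g \<otimes> s [^] i \<otimes> t [^] j) \<in> outside_conn G T n"
      using T g st K ij by (intro full_line_outside_conn) auto
    moreover have "(g \<otimes> t [^] j \<otimes> s [^] i, g \<otimes> t [^] j \<otimes> s [^] (0::int)) \<in> outside_conn G T n"
      using T g st K ij comm[symmetric] by (intro full_line_outside_conn) auto
    ultimately show "(g \<otimes> s [^] i, g \<otimes> t [^] j) \<in> outside_conn G T n"
      using comm outside_conn_trans g st by fastforce
  qed
qed

text \<open>The lines through \<open>g\<close> and \<open>g \<otimes> s\<close> in direction
  \<open>s\<close> coincide; only the parameter moves by one, which costs one in the bound.\<close>

lemma same_end_shift: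
  assumes s: "s \<in> carrier G" "g \<in> carrier G" and "same_end G T n g s g s"
  shows "same_end G T n g s (g \<otimes> s) s"
proof -
  obtain K where K: "\<And>i j. K \<le> \<bar>i\<bar> \<Longrightarrow> K \<le> \<bar>j\<bar> \<Longrightarrow>
        (g \<otimes> s [^] i, g \<otimes> s [^] (j::int)) \<in> outside_conn G T n"
    using assms(3) unfolding same_end_def by blast
  have "g \<otimes> s \<otimes> s [^] (j::int) = g \<otimes> s [^] (1 + j)" for j
    using int_pow_add[OF s, of 1 j] s by simp
  then show ?thesis
    unfolding same_end_def by (intro exI[of _ "K + 1"]) (auto intro!: K)
qed

text \<open>To move from \<open>g\<close> to \<open>g \<otimes> h\<close> for a generator
  \<open>h\<close>, switch at \<open>g\<close> from the line of \<open>s\<close> to the line of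
  \<open>h\<close>, shift along it, and switch back at \<open>g \<otimes> h\<close>. An inverse
  generator uses the same moves in reverse, starting from \<open>g \<otimes> inv h\<close>.\<close>

lemma same_end_everywhere:
  assumes T: "finite T" "T \<subseteq> carrier G"
    and conn: "\<And>g s t. g \<in> carrier G \<Longrightarrow> s \<in> T \<Longrightarrow> t \<in> T \<Longrightarrow> same_end G T n g s g t"
    and s: "s \<in> T" and h: "h \<in> generate G T"
  shows "g \<in> carrier G \<Longrightarrow> same_end G T n g s (g \<otimes> h) s"
  using h
proof (induction arbitrary: g rule: generate.induct)
  case one
  then show ?case using conn s by simp
next
  case (incl h)
  then show ?case using T s
    by (meson conn m_closed same_end_shift same_end_trans subsetD)
next
  case (inv h)
  then have h: "h \<in> carrier G" "g \<otimes> inv h \<in> carrier G" using T by auto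
  then have "same_end G T n (g \<otimes> inv h) h (g \<otimes> inv h \<otimes> h) h"
    using inv by (intro same_end_shift conn) auto
  moreover have "g \<otimes> inv h \<otimes> h = g"
    using h inv by (simp add: m_assoc)
  ultimately show ?case
    using inv h s by (metis conn same_end_sym same_end_trans)
next
  case (eng h1 h2)
  then have "h1 \<in> carrier G" "h2 \<in> carrier G"
    using generate_in_carrier[OF T(2)] by auto
  then show ?case
    using eng.IH(1)[of g] eng.IH(2)[of "g \<otimes> h1"] eng.prems same_end_trans
    by (fastforce simp: m_assoc)
qed

text \<open>
  If both rays of the line \<open>g\<langle>s\<rangle>\<close> meet \<open>X\<close>, then \<open>g\<close> lies between two points of \<open>X\<close> on that line.
\<close>

lemma finite_both_rays_meet:
  assumes s: "s \<in> carrier G" and tf: "\<And>i::int. s [^] i = \<one> \<Longrightarrow> i = 0"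
    and X: "finite X" "X \<subseteq> carrier G"
  shows "finite {g \<in> carrier G. (\<exists>i\<ge>0::int. g \<otimes> s [^] i \<in> X) \<and> (\<exists>i\<le>0::int. g \<otimes> s [^] i \<in> X)}"
    (is "finite ?Z")
proof -
  \<comment> \<open>\<open>A\<close> collects the distances, in steps of \<open>s\<close>, between
    points of \<open>X\<close> on a common line. It is finite because \<open>X\<close> is finite and
    \<open>s\<close> has infinite order.\<close>
  define A where "A = (\<Union>x\<in>X. (\<lambda>i::int. x \<otimes> s [^] i) -` X)"
  have "inj (\<lambda>i::int. x \<otimes> s [^] i)" if "x \<in> X" for x
    using that X s int_pow_inject_of_torsion_free[OF s tf] by (auto intro!: injI)
  then have "finite A"
    unfolding A_def using X by (intro finite_UN_I finite_vimageI) auto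
  then have M: "\<And>i. i \<in> A \<Longrightarrow> i \<le> Max A"
    by (rule Max_ge)
  have "?Z \<subseteq> (\<lambda>(x, i). x \<otimes> s [^] (- i)) ` (X \<times> {0..Max A})"
  proof
    fix g assume "g \<in> ?Z"
    then obtain i j :: int where g: "g \<in> carrier G" and i: "0 \<le> i" "g \<otimes> s [^] i \<in> X"
      and j: "j \<le> 0" "g \<otimes> s [^] j \<in> X" by blast
    have "g \<otimes> s [^] j \<otimes> s [^] (i - j) = g \<otimes> s [^] i"
      by (simp add: int_pow_add s g)
    then have "i - j \<in> A" using i j unfolding A_def by (intro UN_I[of "g \<otimes> s [^] j"]) auto
    \<comment> \<open>The distance from \<open>g\<close> to its forward hit is at most the distance
      \<open>i - j\<close> between the two hits, as \<open>j \<le> 0\<close>.\<close>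
    then have "i \<le> Max A" using M[of "i - j"] j by fastforce
    moreover have "g = g \<otimes> s [^] i \<otimes> s [^] (- i)"
      using g s by (simp add: int_pow_add)
    ultimately show "g \<in> (\<lambda>(x, i). x \<otimes> s [^] (- i)) ` (X \<times> {0..Max A})"
      using i by (auto intro!: image_eqI[of _ _ "(g \<otimes> s [^] i, i)"])
  qed
  then show ?thesis by (rule finite_subset) (use X in auto)
qed

section \<open>The one-endedness criterion\<close>

text \<open>The unbounded component is the class \<open>D\<close> of the far points of the ray
  \<open>s^i\<close>. A vertex with a ray in direction \<open>s\<close> or \<open>inv s\<close> that
  avoids the ball belongs to \<open>D\<close>; the remaining vertices are finitely many, so every
  other component is bounded.\<close>

lemma has_one_end_if_same_end:
  assumes T: "finite T" "T \<subseteq> carrier G" "generate G T = carrier G"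
    and conn: "\<And>n g s t. g \<in> carrier G \<Longrightarrow> s \<in> T \<Longrightarrow> t \<in> T \<Longrightarrow> same_end G T n g s g t"
    and sT: "s \<in> T" and tf: "\<And>i::int. s [^] i = \<one> \<Longrightarrow> i = 0"
  shows "has_one_end G"
proof -
  have s: "s \<in> carrier G" using T sT by auto
  have inj: "inj (\<lambda>i::int. s [^] i)"
    using int_pow_inject_of_torsion_free[OF s tf] by (auto intro: injI)
  have inf: "infinite (carrier G)"
    using inj s infinite_iff_countable_subset finite_imageD[of "\<lambda>i::int. s [^] i" UNIV]
    by (metis finite_subset image_subsetI infinite_UNIV_int int_pow_closed)
  have "\<exists>!C. C \<in> induced_components (cayley_adj G T) (carrier G - cayley_ball G T n) \<and>
             cayley_unbounded G T C" for n
  proof -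
    define B where "B = cayley_ball G T n"
    define X where "X = carrier G - B"
    define E where "E = outside_conn G T n \<inter> X \<times> X"
    have comp: "induced_components (cayley_adj G T) X = X // E"
      unfolding induced_components_def E_def X_def B_def outside_conn_def Let_def by simp
    have equiv: "equiv X E"
    proof (rule equivI)
      show "refl_on X E" unfolding E_def by (simp add: refl_on_def outside_conn_refl)
      show "sym E" unfolding E_def
        by (intro sym_Int sym_outside_conn) (auto simp: sym_def)
      show "trans E" unfolding E_def
        by (intro trans_Int trans_outside_conn) (auto simp: trans_def)
    qed (auto simp: E_def)
    have B: "finite B" "B \<subseteq> carrier G"
      unfolding B_def using finite_cayley_ball[OF T(1,2)] by (auto simp: cayley_ball_def)
    have fin: "finite ((\<lambda>i::int. s [^] i) -` B)"
      using B inj by (intro finite_vimageI) auto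
    define L where "L = Max ((\<lambda>i::int. s [^] i) -` B) + 1"
    have L: "i < L" if "s [^] i \<in> B" for i :: int
      using Max_ge[OF fin, of i] that unfolding L_def by simp
    obtain K where K: "\<And>i j. K \<le> \<bar>i\<bar> \<Longrightarrow> K \<le> \<bar>j\<bar> \<Longrightarrow>
        (\<one> \<otimes> s [^] i, \<one> \<otimes> s [^] (j::int)) \<in> outside_conn G T n"
      using conn[of \<one> s s n] sT unfolding same_end_def by auto
    \<comment> \<open>From exponent \<open>M\<close> on, the powers of \<open>s\<close> are outside
      the ball (by \<open>L\<close>) and mutually connected (by \<open>K\<close>).\<close>
    define M where "M = max \<bar>L\<bar> \<bar>K\<bar>"
    have ray: "(s [^] M, s [^] i) \<in> E" if "M \<le> i" for i
    proof -
      have "s [^] M \<notin> B" "s [^] i \<notin> B" using L[of M] L[of i] that unfolding M_def by linarith+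
      then show ?thesis using K[of M i] that s unfolding E_def X_def M_def by auto
    qed
    define D where "D = E `` {s [^] M}"
    have MX: "s [^] M \<in> X" using ray[of M] unfolding E_def by auto
    have D: "D \<in> X // E" unfolding D_def using MX by (rule quotientI)
    have "infinite D"
    proof -
      have "infinite ((\<lambda>i. s [^] i) ` {M..})"
        using inj infinite_Ici[of M] by (simp add: finite_image_iff inj_on_subset)
      moreover have "(\<lambda>i. s [^] i) ` {M..} \<subseteq> D" unfolding D_def using ray by auto
      ultimately show ?thesis by (rule infinite_super[rotated])
    qed
    then have unb: "cayley_unbounded G T D"
      unfolding cayley_unbounded_def using finite_cayley_ball[OF T(1,2)] finite_subset by blast
    have inD: "g \<in> D" if g: "g \<in> X" and ray': "(\<forall>i\<ge>0::int. g \<otimes> s [^] i \<in> X) \<or> (\<forall>i\<le>0::int. g \<otimes> s [^] i \<in> X)"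
      for g
    proof -
      have gc: "g \<in> carrier G" using g unfolding X_def by simp
      have "same_end G T n \<one> s (\<one> \<otimes> g) s"
        using T conn sT gc by (intro same_end_everywhere) auto
      then obtain J where J: "\<And>i j. J \<le> \<bar>i\<bar> \<Longrightarrow> J \<le> \<bar>j\<bar> \<Longrightarrow>
          (\<one> \<otimes> s [^] i, \<one> \<otimes> g \<otimes> s [^] (j::int)) \<in> outside_conn G T n"
        unfolding same_end_def by auto
      define N where "N = max M \<bar>J\<bar>"
      have N: "N \<ge> M" "N \<ge> 0" "J \<le> N" unfolding N_def by auto
      \<comment> \<open>\<open>same_end\<close> allows exponents of either sign on the line through
        \<open>g\<close>, so whichever ray of \<open>g\<close> avoids the ball can be followed until
        it is linked to \<open>s^N\<close>.\<close>
      have far: "(s [^] N, g \<otimes> s [^] N) \<in> outside_conn G T n"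
        "(s [^] N, g \<otimes> s [^] (- N)) \<in> outside_conn G T n"
        using J[of N N] J[of N "- N"] N s gc by auto
      have "(g \<otimes> s [^] N, g) \<in> outside_conn G T n \<or> (g \<otimes> s [^] (- N), g) \<in> outside_conn G T n"
        using ray'
      proof
        assume "\<forall>i\<ge>0::int. g \<otimes> s [^] i \<in> X"
        then have "(g \<otimes> s [^] (0::int), g \<otimes> s [^] N) \<in> outside_conn G T n"
          using N gc sT T by (intro line_outside_conn) (auto simp: X_def B_def)
        then show ?thesis using gc sym_outside_conn by (metis int_pow_0 r_one symD)
      next
        assume "\<forall>i\<le>0::int. g \<otimes> s [^] i \<in> X"
        then have "(g \<otimes> s [^] (- N), g \<otimes> s [^] (0::int)) \<in> outside_conn G T n"
          using N gc sT T by (intro line_outside_conn) (auto simp: X_def B_def)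
        then show ?thesis using gc by simp
      qed
      then have "(s [^] N, g) \<in> outside_conn G T n"
        using far outside_conn_trans by metis
      then have "(s [^] M, g) \<in> outside_conn G T n"
        using ray[OF N(1)] outside_conn_trans unfolding E_def by fast
      then show ?thesis unfolding D_def E_def using g MX by auto
    qed
    have uniq: "C = D" if C: "C \<in> X // E" and "cayley_unbounded G T C" for C
    proof (rule ccontr)
      assume "C \<noteq> D"
      then have disj: "C \<inter> D = {}" using quotient_disj[OF equiv C D] by auto
      have CX: "C \<subseteq> X" using C equiv in_quotient_imp_subset by metis
      \<comment> \<open>A vertex of \<open>C\<close> outside \<open>Z\<close> would have a free ray
        and hence lie in \<open>D\<close>.\<close>
      define Z where "Z = {g \<in> carrier G. (\<exists>i\<ge>0::int. g \<otimes> s [^] i \<in> B) \<and> (\<exists>i\<le>0::int. g \<otimes> s [^] i \<in> B)}"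
      have "g \<in> Z" if "g \<in> C" for g
        using inD[of g] that disj CX s unfolding Z_def X_def by blast
      then have "C \<subseteq> Z" by auto
      moreover obtain r where "Z \<subseteq> cayley_ball G T r"
        using finite_subset_cayley_ball[OF T(2,3), of Z] finite_both_rays_meet[OF s tf B]
        unfolding Z_def by auto
      ultimately show False using that(2) unfolding cayley_unbounded_def by blast
    qed
    show ?thesis
      using D unb uniq comp unfolding X_def B_def by metis
  qed
  then show ?thesis
    unfolding has_one_end_def using T inf is_group by blast
qed

end

text \<open>Chains of independent pairs compose by transitivity of \<open>same_end\<close>. The
  closure is the irreflexive one: taken at \<open>(s, s)\<close>, it provides a partner independent
  of \<open>s\<close>, and so \<open>s\<close> has infinite order.\<close>

lemma (in group) has_one_end_if_independence_connected:
  assumes T: "finite T" "T \<subseteq> carrier G" "generate G T = carrier G" "T \<noteq> {}"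
    and conn: "\<And>s t. s \<in> T \<Longrightarrow> t \<in> T \<Longrightarrow>
      (s, t) \<in> {(s, t). s \<in> T \<and> t \<in> T \<and> independent G s t}\<^sup>+"
  shows "has_one_end G"
proof -
  let ?R = "{(s, t). s \<in> T \<and> t \<in> T \<and> independent G s t}"
  have same: "same_end G T n g s g t" if "g \<in> carrier G" "(s, t) \<in> ?R\<^sup>+" for n g s t
    using that(2)
  proof induction
    case (base t)
    then show ?case using same_end_independent[OF T(1,2)] that(1) by blast
  next
    case (step t u)
    then have "same_end G T n g t g u" using same_end_independent[OF T(1,2)] that(1) by blast
    then show ?case by (rule same_end_trans[OF step.IH])
  qed
  obtain s where s: "s \<in> T" using T(4) by blast
  then obtain t where "independent G s t"
    using tranclD[OF conn[OF s s]] by blast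
  then have "i = 0" if "s [^] i = \<one>" for i :: int
    using independent_imp_torsion_free that s T(2) by blast
  then show ?thesis
    using has_one_end_if_same_end[OF T(1-3) same[OF _ conn] s] by blast
qed

section \<open>The group structure of F\<close>

text \<open>The breakpoint set is made a parameter, so that it can be enlarged, pulled back along
  one map and pushed forward along another.\<close>

definition affine_on_gaps :: "(real \<Rightarrow> real) \<Rightarrow> real set \<Rightarrow> bool" where
  "affine_on_gaps f B \<longleftrightarrow>
     (\<forall>a b. 0 \<le> a \<and> a < b \<and> b \<le> 1 \<and> {a<..<b} \<inter> B = {} \<longrightarrow>
        (\<exists>(k::int) c. \<forall>x\<in>{a..b}. f x = 2 powi k * x + c))"

text \<open>Both signs are included, which gives closure under subtraction; intercepts of affine
  pieces may be negative.\<close>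

definition dyadic_rationals :: "real set" where
  "dyadic_rationals = {x. \<exists>(i::int) (n::nat). x = i / 2 ^ n}"

lemma affine_on_gapsD:
  assumes "affine_on_gaps f B" "0 \<le> a" "a < b" "b \<le> 1" "{a<..<b} \<inter> B = {}"
  obtains k :: int and c where "\<And>x. x \<in> {a..b} \<Longrightarrow> f x = 2 powi k * x + c"
  using assms unfolding affine_on_gaps_def by meson

lemma affine_on_gaps_superset: "affine_on_gaps f B \<Longrightarrow> B \<subseteq> C \<Longrightarrow> affine_on_gaps f C"
  unfolding affine_on_gaps_def by (meson disjoint_iff subsetD)

lemma dyadic_rationalsI: "x = of_int i / 2 ^ n \<Longrightarrow> x \<in> dyadic_rationals"
  unfolding dyadic_rationals_def by blast

lemma dyadic_rationals_add:
  assumes "x \<in> dyadic_rationals" "y \<in> dyadic_rationals" shows "x + y \<in> dyadic_rationals"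
proof -
  obtain i j :: int and m n :: nat where "x = i / 2 ^ m" "y = j / 2 ^ n"
    using assms unfolding dyadic_rationals_def by blast
  then show ?thesis
    by (intro dyadic_rationalsI[of _ "i * 2 ^ n + j * 2 ^ m" "m + n"])
      (simp add: add_divide_distrib power_add)
qed

lemma dyadic_rationals_mult:
  assumes "x \<in> dyadic_rationals" "y \<in> dyadic_rationals" shows "x * y \<in> dyadic_rationals"
proof -
  obtain i j :: int and m n :: nat where "x = i / 2 ^ m" "y = j / 2 ^ n"
    using assms unfolding dyadic_rationals_def by blast
  then show ?thesis
    by (intro dyadic_rationalsI[of _ "i * j" "m + n"]) (simp add: power_add)
qed

lemma dyadic_rationals_of_int [simp]: "of_int i \<in> dyadic_rationals"
  by (rule dyadic_rationalsI[of _ i 0]) simp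

lemma dyadic_rationals_diff:
  assumes "x \<in> dyadic_rationals" "y \<in> dyadic_rationals" shows "x - y \<in> dyadic_rationals"
  using dyadic_rationals_add[OF assms(1) dyadic_rationals_mult[OF dyadic_rationals_of_int[of "-1"] assms(2)]]
  by simp

lemma dyadic_rationals_powi: "2 powi k \<in> dyadic_rationals"
proof (cases "0 \<le> k")
  case True
  then show ?thesis
    by (intro dyadic_rationalsI[of _ "2 ^ nat k" 0]) (simp add: power_int_def)
next
  case False
  then show ?thesis
    by (intro dyadic_rationalsI[of _ 1 "nat (- k)"]) (simp add: power_int_def field_simps)
qed

lemma dyadics_subset: "dyadics \<subseteq> dyadic_rationals"
proof
  fix x :: real assume "x \<in> dyadics"
  then obtain k m where "x = of_nat m / 2 ^ k" unfolding dyadics_def by blast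
  then show "x \<in> dyadic_rationals" by (intro dyadic_rationalsI[of _ "int m" k]) simp
qed

lemma dyadic_rationals_nonneg:
  assumes "x \<in> dyadic_rationals" "0 \<le> x" shows "x \<in> dyadics"
proof -
  obtain i :: int and n :: nat where x: "x = i / 2 ^ n"
    using assms unfolding dyadic_rationals_def by blast
  have "real_of_int i = x * 2 ^ n" using x by simp
  then have "0 \<le> real_of_int i" using assms(2) by simp
  then have "0 \<le> i" by simp
  then have "x = of_nat (nat i) / 2 ^ n" using x by simp
  then show ?thesis unfolding dyadics_def by blast
qed

text \<open>Induction on the number of breakpoints to the left of \<open>x\<close>, with 0 counted
  as one. If \<open>p\<close> is the last of them, then \<open>f x = f p + 2^k (x - p)\<close>, so
  nothing has to be known about the intercept.\<close>

lemma affine_on_gaps_dyadic: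
  assumes f: "affine_on_gaps f B" and B: "finite B" "B \<subseteq> dyadic_rationals"
    and f0: "f 0 \<in> dyadic_rationals"
  shows "x \<in> dyadic_rationals \<Longrightarrow> x \<in> {0..1} \<Longrightarrow> f x \<in> dyadic_rationals"
proof (induction "card (insert 0 B \<inter> {0..<x})" arbitrary: x rule: less_induct)
  case less
  show ?case
  proof (cases "x = 0")
    case False
    let ?A = "insert 0 B \<inter> {0..<x}"
    have fin: "finite ?A" and ne: "0 \<in> ?A" using B less.prems False by auto
    define p where "p = Max ?A"
    have p: "p \<in> ?A" unfolding p_def using fin ne by (intro Max_in) auto
    have gap: "{p<..<x} \<inter> B = {}"
      using Max_ge[OF fin] p unfolding p_def[symmetric] by fastforce
    obtain k :: int and c where kc: "\<And>y. y \<in> {p..x} \<Longrightarrow> f y = 2 powi k * y + c"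
      using affine_on_gapsD[OF f _ _ _ gap] p less.prems by auto
    have "insert 0 B \<inter> {0..<p} \<subset> ?A" using p by auto
    then have "card (insert 0 B \<inter> {0..<p}) < card ?A" by (rule psubset_card_mono[OF fin])
    moreover have pD: "p \<in> dyadic_rationals"
      using p B dyadic_rationals_of_int[of 0] by auto
    ultimately have "f p \<in> dyadic_rationals" using less p by auto
    moreover have "f x = f p + 2 powi k * (x - p)"
      using kc[of x] kc[of p] p by (simp add: algebra_simps)
    ultimately show ?thesis
      using pD less.prems dyadic_rationals_powi
      by (auto intro: dyadic_rationals_add dyadic_rationals_diff dyadic_rationals_mult)
  qed (use f0 in simp)
qed

text \<open>A gap of \<open>B\<close> contains no preimage of a point of \<open>C\<close>, so
  \<open>f\<close> maps it affinely onto a gap of \<open>C\<close>, where \<open>g\<close> is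
  affine; the exponents of the slopes add.\<close>

lemma affine_on_gaps_compose:
  assumes f: "affine_on_gaps f B" and g: "affine_on_gaps g C"
    and sub: "{x \<in> {0..1}. f x \<in> C} \<subseteq> B"
    and mono: "strict_mono_on {0..1} f" and surj: "f ` {0..1} = {0..1}"
  shows "affine_on_gaps (compose {0..1} g f) B"
  unfolding affine_on_gaps_def
proof (intro allI impI, elim conjE)
  fix a b :: real assume ab: "0 \<le> a" "a < b" "b \<le> 1" "{a<..<b} \<inter> B = {}"
  obtain k :: int and c where kc: "\<And>x. x \<in> {a..b} \<Longrightarrow> f x = 2 powi k * x + c"
    using affine_on_gapsD[OF f ab] by blast
  have le: "f x \<le> f y \<longleftrightarrow> x \<le> y" "f x < f y \<longleftrightarrow> x < y" if "x \<in> {0..1}" "y \<in> {0..1}" for x y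
    using mono that by (auto simp: strict_mono_on_less_eq strict_mono_on_less)
  have "y \<notin> C" if "y \<in> {f a<..<f b}" for y
  proof
    assume "y \<in> C"
    have "f a \<in> {0..1}" "f b \<in> {0..1}" using surj ab by auto
    then have "y \<in> f ` {0..1}" using that surj by auto
    then obtain x where "x \<in> {0..1}" "y = f x" by auto
    moreover from this have "x \<in> {a<..<b}" using that le[of a x] le[of x b] ab by auto
    ultimately show False using ab sub \<open>y \<in> C\<close> by blast
  qed
  moreover have "0 \<le> f a" "f a < f b" "f b \<le> 1"
    using surj le[of a b] ab by auto
  ultimately obtain l :: int and d where ld: "\<And>y. y \<in> {f a..f b} \<Longrightarrow> g y = 2 powi l * y + d"
    using affine_on_gapsD[OF g, of "f a" "f b"] by (metis disjoint_iff)
  have "compose {0..1} g f x = 2 powi (l + k) * x + (2 powi l * c + d)" if "x \<in> {a..b}" for x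
  proof -
    have "compose {0..1} g f x = 2 powi l * f x + d"
      using that ab le[of a x] le[of x b] ld[of "f x"] by (simp add: compose_def)
    then show ?thesis
      using kc[OF that] by (simp add: power_int_add algebra_simps)
  qed
  then show "\<exists>k c. \<forall>x\<in>{a..b}. compose {0..1} g f x = 2 powi k * x + c" by blast
qed

lemma affine_on_gaps_inverse:
  assumes f: "affine_on_gaps f B"
    and mono: "strict_mono_on {0..1} f" and surj: "f ` {0..1} = {0..1}"
    and g: "\<And>x. x \<in> {0..1} \<Longrightarrow> g (f x) = x"
  shows "affine_on_gaps g (f ` B)"
  unfolding affine_on_gaps_def
proof (intro allI impI, elim conjE)
  fix a b :: real assume ab: "0 \<le> a" "a < b" "b \<le> 1" "{a<..<b} \<inter> f ` B = {}"
  have le: "f x \<le> f y \<longleftrightarrow> x \<le> y" "f x < f y \<longleftrightarrow> x < y" if "x \<in> {0..1}" "y \<in> {0..1}" for x y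
    using mono that by (auto simp: strict_mono_on_less_eq strict_mono_on_less)
  have "a \<in> f ` {0..1}" "b \<in> f ` {0..1}" unfolding surj using ab by auto
  then obtain p q where pq: "p \<in> {0..1}" "q \<in> {0..1}" "a = f p" "b = f q" by auto
  have "{p<..<q} \<inter> B = {}"
  proof (rule ccontr)
    assume "{p<..<q} \<inter> B \<noteq> {}"
    then obtain x where x: "x \<in> B" "p < x" "x < q" by auto
    then show False using ab pq le[of p x] le[of x q] by auto
  qed
  then obtain k :: int and c where kc: "\<And>x. x \<in> {p..q} \<Longrightarrow> f x = 2 powi k * x + c"
    using affine_on_gapsD[OF f, of p q] pq le[of p q] ab by auto
  have "g y = 2 powi (- k) * y + (- (2 powi (- k) * c))" if y: "y \<in> {a..b}" for y
  proof -
    have "y \<in> f ` {0..1}" unfolding surj using ab y by auto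
    then obtain x where x: "x \<in> {0..1}" "y = f x" by auto
    then have "x \<in> {p..q}" using y pq le[of p x] le[of x q] by auto
    then have "y = 2 powi k * x + c" using kc x by simp
    then have "x = 2 powi (- k) * y + (- (2 powi (- k) * c))"
      by (simp add: power_int_minus field_simps)
    then show ?thesis using x g by simp
  qed
  then show "\<exists>k c. \<forall>x\<in>{a..b}. g x = 2 powi k * x + c" by blast
qed

lemma dyadic_piecewise_linear_iff:
  "dyadic_piecewise_linear f \<longleftrightarrow>
     (\<exists>B. finite B \<and> B \<subseteq> dyadic_rationals \<inter> {0..1} \<and> affine_on_gaps f B)"
proof -
  have "(dyadics \<inter> {0..1} :: real set) = dyadic_rationals \<inter> {0..1}"
    using dyadics_subset dyadic_rationals_nonneg by auto
  then show ?thesis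
    unfolding dyadic_piecewise_linear_def affine_on_gaps_def by simp
qed

section \<open>Closure of F under inverse and composition\<close>

lemma thompson_F_mapsD:
  assumes "f \<in> thompson_F_maps"
  shows "f \<in> extensional {0..1}" "f ` {0..1} = {0..1}" "strict_mono_on {0..1} f"
    "f \<in> Bij {0..1}" "f 0 = 0" "f 1 = 1"
proof -
  obtain g where g: "homeomorphism {0..1} {0..1} f g"
    and f: "f \<in> extensional {0..1}" "strict_mono_on {0..1} f"
    using assms unfolding thompson_F_maps_def by blast
  then show "f \<in> extensional {0..1}" "strict_mono_on {0..1} f" and im: "f ` {0..1} = {0..1}"
    by (auto simp: homeomorphism_def)
  show "f \<in> Bij {0..1}"
    using f im strict_mono_on_imp_inj_on by (auto simp: Bij_def bij_betw_def)
  have "0 \<in> f ` {0..1}" "1 \<in> f ` {0..1}" unfolding im by auto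
  then obtain x y where xy: "x \<in> {0..1}" "f x = 0" "y \<in> {0..1}" "f y = 1" by auto
  have "f 0 \<in> {0..1}" "f 1 \<in> {0..1}" using im by auto
  then show "f 0 = 0" "f 1 = 1"
    using strict_mono_on_less_eq[OF f(2), of 0 x] strict_mono_on_less_eq[OF f(2), of y 1] xy by auto
qed

lemma thompson_F_mapsI:
  assumes "f \<in> extensional {0..1}" "homeomorphism {0..1} {0..1} f g" "strict_mono_on {0..1} f"
    "finite B" "B \<subseteq> dyadic_rationals \<inter> {0..1}" "affine_on_gaps f B"
  shows "f \<in> thompson_F_maps"
  using assms unfolding thompson_F_maps_def dyadic_piecewise_linear_iff by blast

lemma thompson_F_maps_breakpoints:
  assumes "f \<in> thompson_F_maps"
  obtains B where "finite B" "B \<subseteq> dyadic_rationals \<inter> {0..1}" "affine_on_gaps f B"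
  using assms unfolding thompson_F_maps_def dyadic_piecewise_linear_iff by blast

lemma thompson_F_maps_dyadic:
  assumes "f \<in> thompson_F_maps" "x \<in> dyadic_rationals \<inter> {0..1}"
  shows "f x \<in> dyadic_rationals \<inter> {0..1}"
proof -
  obtain B where B: "finite B" "B \<subseteq> dyadic_rationals \<inter> {0..1}" "affine_on_gaps f B"
    using thompson_F_maps_breakpoints[OF assms(1)] .
  have "f 0 \<in> dyadic_rationals"
    unfolding thompson_F_mapsD(5)[OF assms(1)] using dyadic_rationals_of_int[of 0] by simp
  then have "f x \<in> dyadic_rationals"
    using affine_on_gaps_dyadic[OF B(3,1)] B(2) assms(2) by blast
  then show ?thesis using thompson_F_mapsD(2)[OF assms(1)] assms(2) by blast
qed

lemma inverse_in_thompson_F_maps: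
  assumes f: "f \<in> thompson_F_maps"
  shows "(\<lambda>x\<in>{0..1}. inv_into {0..1} f x) \<in> thompson_F_maps"
proof -
  define g where "g = (\<lambda>x\<in>{0..1}. inv_into {0..1} f x)"
  note F = thompson_F_mapsD[OF f]
  have inj: "inj_on f {0..1}" using F(4) by (simp add: Bij_def bij_betw_def)
  obtain h where h: "homeomorphism {0..1} {0..1} f h"
    using f unfolding thompson_F_maps_def by blast
  obtain B where B: "finite B" "B \<subseteq> dyadic_rationals \<inter> {0..1}" "affine_on_gaps f B"
    using thompson_F_maps_breakpoints[OF f] .
  have fI: "f x \<in> {0..1}" if "x \<in> {0..1}" for x using F(2) that by blast
  have gf: "g (f x) = x" if "x \<in> {0..1}" for x
    using that inj fI[OF that] by (simp add: g_def)
  have fg: "f (g y) = y" "g y \<in> {0..1}" if "y \<in> {0..1}" for y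
  proof -
    have y: "y \<in> f ` {0..1}" using that F(2) by blast
    show "f (g y) = y" "g y \<in> {0..1}"
      using that f_inv_into_f[OF y] inv_into_into[OF y] by (simp_all add: g_def)
  qed
  \<comment> \<open>The inverse provided by the homeomorphism agrees with \<open>g\<close> on the
    unit interval, which transfers continuity to \<open>g\<close>.\<close>
  have "g y = h y" if "y \<in> {0..1}" for y
    using homeomorphism_apply1[OF h fg(2)[OF that]] fg(1)[OF that] by simp
  then have hom: "homeomorphism {0..1} {0..1} g f"
    by (intro homeomorphism_cong[OF homeomorphism_symD[OF h]]) simp_all
  have "g \<in> thompson_F_maps"
  proof (rule thompson_F_mapsI[OF _ hom])
    show "g \<in> extensional {0..1}" by (simp add: g_def)
    show "strict_mono_on {0..1} g"
    proof (rule strict_mono_onI)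
      fix r s :: real assume rs: "r \<in> {0..1}" "s \<in> {0..1}" "r < s"
      show "g r < g s"
        using strict_mono_on_less[OF F(3) fg(2)[OF rs(1)] fg(2)[OF rs(2)]]
          fg(1)[OF rs(1)] fg(1)[OF rs(2)] rs(3) by simp
    qed
    show "finite (f ` B)" using B by simp
    show "f ` B \<subseteq> dyadic_rationals \<inter> {0..1}"
      using thompson_F_maps_dyadic[OF f] B by blast
    show "affine_on_gaps g (f ` B)"
      by (rule affine_on_gaps_inverse[OF B(3) F(3,2) gf])
  qed
  then show ?thesis unfolding g_def .
qed

lemma compose_in_thompson_F_maps:
  assumes f: "f \<in> thompson_F_maps" and g: "g \<in> thompson_F_maps"
  shows "compose {0..1} g f \<in> thompson_F_maps"
proof -
  note F = thompson_F_mapsD[OF f] and G = thompson_F_mapsD[OF g]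
  have fI: "f x \<in> {0..1}" if "x \<in> {0..1}" for x using F(2) that by blast
  obtain f' g' where "homeomorphism {0..1} {0..1} f f'" "homeomorphism {0..1} {0..1} g g'"
    using f g unfolding thompson_F_maps_def by blast
  then have "homeomorphism {0..1} {0..1} (g \<circ> f) (f' \<circ> g')"
    by (rule homeomorphism_compose)
  then have hom: "homeomorphism {0..1} {0..1} (compose {0..1} g f) (f' \<circ> g')"
    by (rule homeomorphism_cong) (simp_all add: compose_def)
  obtain B where B: "finite B" "B \<subseteq> dyadic_rationals \<inter> {0..1}" "affine_on_gaps f B"
    using thompson_F_maps_breakpoints[OF f] .
  obtain C where C: "finite C" "C \<subseteq> dyadic_rationals \<inter> {0..1}" "affine_on_gaps g C"
    using thompson_F_maps_breakpoints[OF g] .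
  define h where "h = (\<lambda>x\<in>{0..1}. inv_into {0..1} f x)"
  have h: "h \<in> thompson_F_maps" unfolding h_def by (rule inverse_in_thompson_F_maps[OF f])
  have inj: "inj_on f {0..1}" using F(4) by (simp add: Bij_def bij_betw_def)
  have hf: "h (f x) = x" if "x \<in> {0..1}" for x
    using that inj fI[OF that] by (simp add: h_def)
  show ?thesis
  proof (rule thompson_F_mapsI[OF _ hom])
    show "strict_mono_on {0..1} (compose {0..1} g f)"
    proof (rule strict_mono_onI)
      fix r s :: real assume rs: "r \<in> {0..1}" "s \<in> {0..1}" "r < s"
      have "f r < f s" using strict_mono_on_less[OF F(3) rs(1,2)] rs(3) by simp
      then show "compose {0..1} g f r < compose {0..1} g f s"
        using strict_mono_on_less[OF G(3) fI[OF rs(1)] fI[OF rs(2)]] rs by (simp add: compose_def)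
    qed
    show "finite (B \<union> h ` C)" using B C by simp
    show "B \<union> h ` C \<subseteq> dyadic_rationals \<inter> {0..1}"
      using B C thompson_F_maps_dyadic[OF h] by blast
    show "affine_on_gaps (compose {0..1} g f) (B \<union> h ` C)"
    proof (rule affine_on_gaps_compose[OF _ C(3) _ F(3,2)])
      show "affine_on_gaps f (B \<union> h ` C)"
        by (rule affine_on_gaps_superset[OF B(3)]) simp
      show "{x \<in> {0..1}. f x \<in> C} \<subseteq> B \<union> h ` C"
      proof
        fix x assume "x \<in> {x \<in> {0..1}. f x \<in> C}"
        then have "x = h (f x)" "f x \<in> C" using hf[of x] by simp_all
        then show "x \<in> B \<union> h ` C" by blast
      qed
    qed
  qed simp
qed

lemma identity_in_thompson_F_maps: "(\<lambda>x\<in>{0..1}. x) \<in> thompson_F_maps"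
proof (rule thompson_F_mapsI)
  show "homeomorphism {0..1} {0..1} (\<lambda>x\<in>{0..1}. x) (\<lambda>x::real. x)"
    by (rule homeomorphism_cong[OF homeomorphism_ident]) auto
  show "strict_mono_on {0..1} (\<lambda>x\<in>{0..1}. x :: real)"
    by (auto simp: strict_mono_on_def)
  show "affine_on_gaps (\<lambda>x\<in>{0..1}. x) {}"
    unfolding affine_on_gaps_def by (auto intro!: exI[of _ 0])
qed auto

lemma subgroup_thompson_F_maps: "subgroup thompson_F_maps (BijGroup {0..1})"
proof (rule subgroup.intro)
  show "thompson_F_maps \<subseteq> carrier (BijGroup {0..1})"
    using thompson_F_mapsD(4) by (auto simp: BijGroup_def)
  show "f \<otimes>\<^bsub>BijGroup {0..1}\<^esub> g \<in> thompson_F_maps"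
    if "f \<in> thompson_F_maps" "g \<in> thompson_F_maps" for f g
    using that compose_in_thompson_F_maps thompson_F_mapsD(4) by (simp add: BijGroup_def)
  show "\<one>\<^bsub>BijGroup {0..1}\<^esub> \<in> thompson_F_maps"
    using identity_in_thompson_F_maps by (simp add: BijGroup_def)
  show "inv\<^bsub>BijGroup {0..1}\<^esub> f \<in> thompson_F_maps" if "f \<in> thompson_F_maps" for f
    using inverse_in_thompson_F_maps[OF that] inv_BijGroup[OF thompson_F_mapsD(4)[OF that]] by simp
qed

interpretation thompson: group thompson_F
  unfolding thompson_F_def
  using subgroup.subgroup_is_group[OF subgroup_thompson_F_maps group_BijGroup] .

lemma carrier_thompson_F: "carrier thompson_F = thompson_F_maps"
  by (simp add: thompson_F_def)

lemma thompson_F_mult_apply: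
  assumes "f \<in> carrier thompson_F" "g \<in> carrier thompson_F" "x \<in> {0..1}"
  shows "(f \<otimes>\<^bsub>thompson_F\<^esub> g) x = f (g x)"
  using assms thompson_F_mapsD(4)
  by (simp add: carrier_thompson_F) (simp add: thompson_F_def BijGroup_def compose_def)

lemma thompson_F_one_apply: "x \<in> {0..1} \<Longrightarrow> \<one>\<^bsub>thompson_F\<^esub> x = x"
  by (simp add: thompson_F_def BijGroup_def)

lemma thompson_F_range: "f \<in> carrier thompson_F \<Longrightarrow> x \<in> {0..1} \<Longrightarrow> f x \<in> {0..1}"
  using thompson_F_mapsD(2)[of f] by (auto simp only: carrier_thompson_F)

lemma thompson_F_less:
  "f \<in> carrier thompson_F \<Longrightarrow> x \<in> {0..1} \<Longrightarrow> y \<in> {0..1} \<Longrightarrow> f x < f y \<longleftrightarrow> x < y"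
  using thompson_F_mapsD(3)[of f] strict_mono_on_less[of "{0..1}" f x y]
  by (simp only: carrier_thompson_F)

lemma thompson_F_le:
  "f \<in> carrier thompson_F \<Longrightarrow> x \<in> {0..1} \<Longrightarrow> y \<in> {0..1} \<Longrightarrow> f x \<le> f y \<longleftrightarrow> x \<le> y"
  using thompson_F_mapsD(3)[of f] strict_mono_on_less_eq[of "{0..1}" f x y]
  by (simp only: carrier_thompson_F)

lemma thompson_F_eqI:
  assumes "f \<in> carrier thompson_F" "g \<in> carrier thompson_F" "\<And>x. x \<in> {0..1} \<Longrightarrow> f x = g x"
  shows "f = g"
  using assms by (intro extensionalityI[of f "{0..1}" g] thompson_F_mapsD(1)) (simp_all only: carrier_thompson_F)

lemma thompson_F_inv_apply:
  assumes "f \<in> carrier thompson_F" "x \<in> {0..1}"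
  shows "(inv\<^bsub>thompson_F\<^esub> f) (f x) = x"
  using thompson_F_mult_apply[OF thompson.inv_closed[OF assms(1)] assms]
    thompson_F_one_apply[OF assms(2)] assms(1) by simp

section \<open>Torsion-freeness and disjoint supports\<close>

text \<open>If \<open>f\<close> moves \<open>x\<close> down, monotonicity gives
  \<open>f^(m+1) (f x) < f^(m+1) x\<close>, so all positive powers move \<open>x\<close> down;
  likewise upwards.\<close>

lemma thompson_F_torsion_free:
  assumes f: "f \<in> carrier thompson_F" "f \<noteq> \<one>\<^bsub>thompson_F\<^esub>" and i: "f [^]\<^bsub>thompson_F\<^esub> (i::int) = \<one>\<^bsub>thompson_F\<^esub>"
  shows "i = 0"
proof -
  obtain x where x: "x \<in> {0..1}" "f x \<noteq> x"
    using f thompson_F_eqI[of f "\<one>\<^bsub>thompson_F\<^esub>"] thompson_F_one_apply by fastforce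
  have step: "(f [^]\<^bsub>thompson_F\<^esub> Suc n) x = (f [^]\<^bsub>thompson_F\<^esub> n) (f x)"
    and pow: "f [^]\<^bsub>thompson_F\<^esub> n \<in> carrier thompson_F" for n :: nat
    using f x by (auto simp: thompson_F_mult_apply)
  have ne: "(f [^]\<^bsub>thompson_F\<^esub> n) x \<noteq> x" if "n \<noteq> 0" for n :: nat
  proof (cases "f x < x")
    case True
    have "(f [^]\<^bsub>thompson_F\<^esub> Suc m) x < x" for m
    proof (induction m)
      case 0 then show ?case using True f by simp
    next
      case (Suc m)
      have "(f [^]\<^bsub>thompson_F\<^esub> Suc m) (f x) < (f [^]\<^bsub>thompson_F\<^esub> Suc m) x"
        using True x pow thompson_F_range[OF f(1)] thompson_F_less[OF pow] by blast
      then show ?case using Suc step by (metis less_trans)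
    qed
    then show ?thesis using that by (metis less_irrefl not0_implies_Suc)
  next
    case False
    then have gt: "f x > x" using x by simp
    have "(f [^]\<^bsub>thompson_F\<^esub> Suc m) x > x" for m
    proof (induction m)
      case 0 then show ?case using gt f by simp
    next
      case (Suc m)
      have "(f [^]\<^bsub>thompson_F\<^esub> Suc m) (f x) > (f [^]\<^bsub>thompson_F\<^esub> Suc m) x"
        using gt x pow thompson_F_range[OF f(1)] thompson_F_less[OF pow] by blast
      then show ?case using Suc step by (metis less_trans)
    qed
    then show ?thesis using that by (metis less_irrefl not0_implies_Suc)
  qed
  have "f [^]\<^bsub>thompson_F\<^esub> n \<noteq> \<one>\<^bsub>thompson_F\<^esub>" if "n \<noteq> 0" for n :: nat
    using ne[OF that] thompson_F_one_apply[OF x(1)] by auto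
  \<comment> \<open>Order 0 encodes infinite order, and the only integer divisible by 0 is
    0.\<close>
  then have "thompson.ord f = 0" using thompson.ord_eq_0[OF f(1)] by blast
  then show ?thesis using thompson.int_pow_eq_id[OF f(1), of i] i by simp
qed

text \<open>Pointwise stabilisers stand in for supports: fixing \<open>{p..1}\<close> means being
  supported in \<open>{0..p}\<close>.\<close>

definition thompson_F_fixer :: "real set \<Rightarrow> (real \<Rightarrow> real) set" where
  "thompson_F_fixer A = {f \<in> carrier thompson_F. \<forall>x\<in>A. f x = x}"

lemma subgroup_thompson_F_fixer:
  assumes A: "A \<subseteq> {0..1}"
  shows "subgroup (thompson_F_fixer A) thompson_F"
proof (rule thompson.subgroupI)
  show "thompson_F_fixer A \<noteq> {}"
    using A thompson_F_one_apply unfolding thompson_F_fixer_def by blast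
  fix f assume f: "f \<in> thompson_F_fixer A"
  have "(inv\<^bsub>thompson_F\<^esub> f) x = x" if "x \<in> A" for x
    using thompson_F_inv_apply[of f x] f that A unfolding thompson_F_fixer_def by auto
  then show "inv\<^bsub>thompson_F\<^esub> f \<in> thompson_F_fixer A"
    using f unfolding thompson_F_fixer_def by simp
  fix g assume g: "g \<in> thompson_F_fixer A"
  show "f \<otimes>\<^bsub>thompson_F\<^esub> g \<in> thompson_F_fixer A"
    using f g A thompson_F_mult_apply[of f g] unfolding thompson_F_fixer_def by auto
qed (auto simp: thompson_F_fixer_def)

text \<open>Both elements fix \<open>p\<close>, so each half is mapped into itself by the element
  that may move it, and the other element is the identity there.\<close>

lemma thompson_F_commute:
  assumes s: "s \<in> thompson_F_fixer {p..1}" and t: "t \<in> thompson_F_fixer {0..p}"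
    and p: "p \<in> {0..1}"
  shows "s \<otimes>\<^bsub>thompson_F\<^esub> t = t \<otimes>\<^bsub>thompson_F\<^esub> s"
proof -
  have F: "s \<in> carrier thompson_F" "t \<in> carrier thompson_F"
    and fixes_: "\<And>x. x \<in> {p..1} \<Longrightarrow> s x = x" "\<And>x. x \<in> {0..p} \<Longrightarrow> t x = x"
    using s t unfolding thompson_F_fixer_def by blast+
  show ?thesis
  proof (rule thompson_F_eqI)
    fix x :: real assume x: "x \<in> {0..1}"
    have "s (t x) = t (s x)"
    proof (cases "x \<le> p")
      case True
      then have "s x \<le> s p" using thompson_F_le[OF F(1) x p] by simp
      then have "s x \<in> {0..p}" using fixes_(1)[of p] p thompson_F_range[OF F(1) x] by simp
      then show ?thesis using fixes_(2) True x by simp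
    next
      case False
      then have "t p \<le> t x" using thompson_F_le[OF F(2) p x] by simp
      then have "t x \<in> {p..1}" using fixes_(2)[of p] p thompson_F_range[OF F(2) x] by simp
      then show ?thesis using fixes_(1) False x by simp
    qed
    then show "(s \<otimes>\<^bsub>thompson_F\<^esub> t) x = (t \<otimes>\<^bsub>thompson_F\<^esub> s) x"
      using thompson_F_mult_apply[OF F x] thompson_F_mult_apply[OF F(2,1) x] by simp
  qed (use F in simp_all)
qed

text \<open>A relation gives \<open>s^i = t^(-j)\<close>. This element fixes both halves, hence is
  the identity, and torsion-freeness yields \<open>i = j = 0\<close>.\<close>

lemma thompson_F_independent:
  assumes s: "s \<in> thompson_F_fixer {p..1}" "s \<noteq> \<one>\<^bsub>thompson_F\<^esub>"
    and t: "t \<in> thompson_F_fixer {0..p}" "t \<noteq> \<one>\<^bsub>thompson_F\<^esub>"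
    and p: "p \<in> {0..1}"
  shows "independent thompson_F s t"
  unfolding independent_def
proof (intro conjI allI impI)
  show "s \<otimes>\<^bsub>thompson_F\<^esub> t = t \<otimes>\<^bsub>thompson_F\<^esub> s" by (rule thompson_F_commute[OF s(1) t(1) p])
next
  have F: "s \<in> carrier thompson_F" "t \<in> carrier thompson_F"
    using s t unfolding thompson_F_fixer_def by blast+
  fix i j :: int
  assume st: "s [^]\<^bsub>thompson_F\<^esub> i \<otimes>\<^bsub>thompson_F\<^esub> t [^]\<^bsub>thompson_F\<^esub> j = \<one>\<^bsub>thompson_F\<^esub>"
  have "s [^]\<^bsub>thompson_F\<^esub> i = inv\<^bsub>thompson_F\<^esub> (t [^]\<^bsub>thompson_F\<^esub> j)"
    using thompson.inv_equality[OF st] F by simp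
  then have eq: "s [^]\<^bsub>thompson_F\<^esub> i = t [^]\<^bsub>thompson_F\<^esub> (- j)"
    using F by (simp add: thompson.int_pow_neg)
  have "s [^]\<^bsub>thompson_F\<^esub> i \<in> thompson_F_fixer {p..1}"
    using p by (intro thompson.subgroup_int_pow_closed[OF subgroup_thompson_F_fixer] s(1)) simp
  moreover have "t [^]\<^bsub>thompson_F\<^esub> (- j) \<in> thompson_F_fixer {0..p}"
    using p by (intro thompson.subgroup_int_pow_closed[OF subgroup_thompson_F_fixer] t(1)) simp
  ultimately have fix_: "(s [^]\<^bsub>thompson_F\<^esub> i) x = x" if "x \<in> {0..1}" for x
    using that unfolding eq thompson_F_fixer_def by (cases "x \<le> p") auto
  have "s [^]\<^bsub>thompson_F\<^esub> i = \<one>\<^bsub>thompson_F\<^esub>"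
    using F fix_ by (intro thompson_F_eqI) (simp_all only: thompson_F_one_apply thompson.int_pow_closed thompson.one_closed)
  then show "i = 0" "j = 0"
    using thompson_F_torsion_free[OF F(1) s(2), of i] thompson_F_torsion_free[OF F(2) t(2), of "- j"]
      eq by simp_all
qed

section \<open>Finite generation of F\<close>

text \<open>The standard generator \<open>x\<^sub>i\<close>, conjugated by the reflection \<open>u \<mapsto> 1 - u\<close>.\<close>

definition thompson_gen :: "nat \<Rightarrow> real \<Rightarrow> real" where
  "thompson_gen i =
     (\<lambda>u\<in>{0..1}. min u (max (u / 2) (max (u - 1 / 2 ^ i / 4) (2 * u - 1 / 2 ^ i))))"

text \<open>With \<open>e = 1 / 2^i\<close>, the lines in the maximum have slopes 1/2, 1 and 2 and
  take over from one another at \<open>e/2\<close> and \<open>3e/4\<close>; the minimum with the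
  diagonal takes effect from \<open>e\<close> on. The support therefore lies in
  \<open>[0, e]\<close>.\<close>

lemma thompson_gen_apply:
  assumes "0 \<le> u" "u \<le> 1"
  shows "u \<le> 1 / 2 ^ i / 2 \<Longrightarrow> thompson_gen i u = u / 2"
    and "1 / 2 ^ i / 2 \<le> u \<Longrightarrow> u \<le> 3 * (1 / 2 ^ i) / 4 \<Longrightarrow> thompson_gen i u = u - 1 / 2 ^ i / 4"
    and "3 * (1 / 2 ^ i) / 4 \<le> u \<Longrightarrow> u \<le> 1 / 2 ^ i \<Longrightarrow> thompson_gen i u = 2 * u - 1 / 2 ^ i"
    and "1 / 2 ^ i \<le> u \<Longrightarrow> thompson_gen i u = u"
proof -
  define e :: real where "e = 1 / 2 ^ i"
  have e: "0 < e" unfolding e_def by simp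
  have gen: "thompson_gen i u = min u (max (u / 2) (max (u - e / 4) (2 * u - e)))"
    using assms unfolding thompson_gen_def e_def by simp
  have "u \<le> e / 2 \<Longrightarrow> thompson_gen i u = u / 2"
    unfolding gen using e assms by (simp add: min_def max_def)
  moreover have "e / 2 \<le> u \<Longrightarrow> u \<le> 3 * e / 4 \<Longrightarrow> thompson_gen i u = u - e / 4"
    unfolding gen using e assms by (simp add: min_def max_def)
  moreover have "3 * e / 4 \<le> u \<Longrightarrow> u \<le> e \<Longrightarrow> thompson_gen i u = 2 * u - e"
    unfolding gen using e assms by (simp add: min_def max_def)
  moreover have "e \<le> u \<Longrightarrow> thompson_gen i u = u"
    unfolding gen using e assms by (simp add: min_def max_def)
  ultimately show "u \<le> 1 / 2 ^ i / 2 \<Longrightarrow> thompson_gen i u = u / 2"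
    "1 / 2 ^ i / 2 \<le> u \<Longrightarrow> u \<le> 3 * (1 / 2 ^ i) / 4 \<Longrightarrow> thompson_gen i u = u - 1 / 2 ^ i / 4"
    "3 * (1 / 2 ^ i) / 4 \<le> u \<Longrightarrow> u \<le> 1 / 2 ^ i \<Longrightarrow> thompson_gen i u = 2 * u - 1 / 2 ^ i"
    "1 / 2 ^ i \<le> u \<Longrightarrow> thompson_gen i u = u"
    unfolding e_def by blast+
qed

lemma affine_on_gaps_thompson_gen:
  "affine_on_gaps (thompson_gen i) {1 / 2 ^ i / 2, 3 * (1 / 2 ^ i) / 4, 1 / 2 ^ i}"
proof -
  define e :: real where "e = 1 / 2 ^ i"
  have "affine_on_gaps (thompson_gen i) {e / 2, 3 * e / 4, e}"
    unfolding affine_on_gaps_def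
  proof (intro allI impI, elim conjE)
    fix a b :: real assume ab: "0 \<le> a" "a < b" "b \<le> 1" "{a<..<b} \<inter> {e / 2, 3 * e / 4, e} = {}"
    then have out: "e / 2 \<le> a \<or> b \<le> e / 2" "3 * e / 4 \<le> a \<or> b \<le> 3 * e / 4" "e \<le> a \<or> b \<le> e"
      by (auto simp: not_less)
    then consider "b \<le> e / 2" | "e / 2 \<le> a" "b \<le> 3 * e / 4" | "3 * e / 4 \<le> a" "b \<le> e" | "e \<le> a"
      by argo
    then show "\<exists>k c. \<forall>x\<in>{a..b}. thompson_gen i x = 2 powi k * x + c"
    proof cases
      case 1
      then have "\<forall>x\<in>{a..b}. thompson_gen i x = 2 powi (- 1) * x + 0"
        using ab thompson_gen_apply(1)[of _ i] by (simp add: e_def)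
      then show ?thesis by blast
    next
      case 2
      then have "\<forall>x\<in>{a..b}. thompson_gen i x = 2 powi 0 * x + (- (e / 4))"
        using ab thompson_gen_apply(2)[of _ i] by (simp add: e_def)
      then show ?thesis by blast
    next
      case 3
      then have "\<forall>x\<in>{a..b}. thompson_gen i x = 2 powi 1 * x + (- e)"
        using ab thompson_gen_apply(3)[of _ i] by (simp add: e_def)
      then show ?thesis by blast
    next
      case 4
      then have "\<forall>x\<in>{a..b}. thompson_gen i x = 2 powi 0 * x + 0"
        using ab thompson_gen_apply(4)[of _ i] by (simp add: e_def)
      then show ?thesis by blast
    qed
  qed
  then show ?thesis unfolding e_def .
qed

text \<open>The formula by \<open>min\<close> and \<open>max\<close> of increasing lines gives
  continuity and strict monotonicity without case distinctions. The intermediate value theorem gives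
  surjectivity, and compactness a continuous inverse.\<close>

lemma thompson_gen_in_carrier: "thompson_gen i \<in> carrier thompson_F"
proof -
  define e :: real where "e = 1 / 2 ^ i"
  have e: "0 < e" "e \<le> 1" unfolding e_def by auto
  have gen: "thompson_gen i u = min u (max (u / 2) (max (u - e / 4) (2 * u - e)))" if "u \<in> {0..1}" for u
    using that unfolding thompson_gen_def e_def by simp
  have cont: "continuous_on {0..1} (thompson_gen i)"
  proof -
    have "continuous_on {0..1} (\<lambda>u. min u (max (u / 2) (max (u - e / 4) (2 * u - e))))"
      by (intro continuous_intros) simp
    then show ?thesis by (rule continuous_on_eq) (simp only: gen)
  qed
  have mono: "strict_mono_on {0..1} (thompson_gen i)"
  proof (rule strict_mono_onI)
    have max: "max a b < max c d" and min: "min a b < min c d" if "a < c" "b < d" for a b c d :: real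
      using that by (auto simp: max_def min_def)
    fix r s :: real assume "r \<in> {0..1}" "s \<in> {0..1}" "r < s"
    then show "thompson_gen i r < thompson_gen i s"
      unfolding gen[OF \<open>r \<in> {0..1}\<close>] gen[OF \<open>s \<in> {0..1}\<close>] by (intro max min) simp_all
  qed
  have ends: "thompson_gen i 0 = 0" "thompson_gen i 1 = 1"
    using e thompson_gen_apply(1)[of 0 i] thompson_gen_apply(4)[of 1 i] by (simp_all add: e_def)
  have im: "thompson_gen i ` {0..1} = {0..1}"
  proof
    show "thompson_gen i ` {0..1} \<subseteq> {0..1}"
    proof
      fix y assume "y \<in> thompson_gen i ` {0..1}"
      then obtain u where u: "u \<in> {0..1}" "y = thompson_gen i u" by auto
      have "y \<le> u" unfolding u(2) gen[OF u(1)] by (rule min.cobounded1)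
      moreover have "u / 2 \<le> y" unfolding u(2) gen[OF u(1)] using u(1) by simp
      ultimately show "y \<in> {0..1}" using u(1) by auto
    qed
    show "{0..1} \<subseteq> thompson_gen i ` {0..1}"
    proof
      fix y :: real assume "y \<in> {0..1}"
      then obtain x where "0 \<le> x" "x \<le> 1" "thompson_gen i x = y"
        using IVT'[of "thompson_gen i" 0 y 1, unfolded ends, OF _ _ _ cont] by auto
      then show "y \<in> thompson_gen i ` {0..1}" by (intro image_eqI[of _ _ x]) simp_all
    qed
  qed
  obtain g where hom: "homeomorphism {0..1} {0..1} (thompson_gen i) g"
    using homeomorphism_compact[OF compact_Icc cont im strict_mono_on_imp_inj_on[OF mono]] by blast
  have D: "e / 2 \<in> dyadic_rationals" "3 * e / 4 \<in> dyadic_rationals" "e \<in> dyadic_rationals"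
    using dyadic_rationalsI[of "e / 2" 1 "Suc i"] dyadic_rationalsI[of "3 * e / 4" 3 "Suc (Suc i)"]
      dyadic_rationalsI[of e 1 i] by (simp_all add: e_def)
  have "thompson_gen i \<in> thompson_F_maps"
  proof (rule thompson_F_mapsI[OF _ hom mono])
    show "thompson_gen i \<in> extensional {0..1}" by (simp add: thompson_gen_def)
    show "{e / 2, 3 * e / 4, e} \<subseteq> dyadic_rationals \<inter> {0..1}" using D e by simp
    show "affine_on_gaps (thompson_gen i) {e / 2, 3 * e / 4, e}"
      using affine_on_gaps_thompson_gen[of i] unfolding e_def .
  qed simp
  then show ?thesis unfolding carrier_thompson_F .
qed

text \<open>This is the defining relation \<open>x_(i+1) = x_0 x_i x_0^(-1)\<close> of F. On
  \<open>[0, 1/2]\<close> the map \<open>thompson_gen 0\<close> is halving, which rescales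
  \<open>thompson_gen i\<close> to \<open>thompson_gen (Suc i)\<close>; above 1/2 both sides equal
  \<open>thompson_gen 0\<close>, as \<open>i > 0\<close> keeps the support of
  \<open>thompson_gen i\<close> inside \<open>[0, 1/2]\<close>.\<close>

lemma thompson_gen_conj:
  assumes "0 < i"
  shows "thompson_gen 0 \<otimes>\<^bsub>thompson_F\<^esub> thompson_gen i =
    thompson_gen (Suc i) \<otimes>\<^bsub>thompson_F\<^esub> thompson_gen 0"
proof (rule thompson_F_eqI)
  fix u :: real assume u: "u \<in> {0..1}"
  define e :: real where "e = 1 / 2 ^ i"
  have e: "0 < e" "e \<le> 1 / 2"
    using assms unfolding e_def by (auto simp: field_simps self_le_power dest: Suc_leI)
  have gen: "thompson_gen i u = min u (max (u / 2) (max (u - e / 4) (2 * u - e)))"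
    "thompson_gen (Suc i) u = min u (max (u / 2) (max (u - e / 8) (2 * u - e / 2)))"
    "thompson_gen 0 u = min u (max (u / 2) (max (u - 1 / 4) (2 * u - 1)))" if "u \<in> {0..1}" for u
    using that unfolding thompson_gen_def e_def by simp_all
  have "thompson_gen 0 (thompson_gen i u) = thompson_gen (Suc i) (thompson_gen 0 u)"
  proof (cases "u \<le> 1 / 2")
    case True
    have "thompson_gen 0 u = u / 2" using u True by (intro thompson_gen_apply(1)) auto
    moreover have "thompson_gen i u \<le> u" unfolding gen(1)[OF u] by (rule min.cobounded1)
    then have "thompson_gen 0 (thompson_gen i u) = thompson_gen i u / 2"
      using thompson_F_range[OF thompson_gen_in_carrier u, of i] u True
      by (intro thompson_gen_apply(1)) auto
    moreover have "thompson_gen (Suc i) (u / 2) = thompson_gen i u / 2"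
    proof -
      have half: "max a b / 2 = max (a / 2) (b / 2)" "min a b / 2 = min (a / 2) (b / 2)" for a b :: real
        by (simp_all add: max_def min_def)
      have "u / 2 \<in> {0..1}" using u by simp
      then show ?thesis
        unfolding gen(1)[OF u] half by (simp add: gen(2) diff_divide_distrib)
    qed
    ultimately show ?thesis by metis
  next
    case False
    have "thompson_gen i u = u"
      using u e False thompson_gen_apply(4)[of u i, folded e_def] by simp
    moreover have "thompson_gen (Suc i) (thompson_gen 0 u) = thompson_gen 0 u"
    proof -
      have e2: "1 / 2 ^ Suc i = e / 2" unfolding e_def by simp
      have "e / 2 \<le> thompson_gen 0 u"
        unfolding gen(3)[OF u] using e False by (simp add: le_max_iff_disj)
      then show ?thesis
        using thompson_F_range[OF thompson_gen_in_carrier u, of 0]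
          thompson_gen_apply(4)[of "thompson_gen 0 u" "Suc i", unfolded e2] by simp
    qed
    ultimately show ?thesis by simp
  qed
  then show "(thompson_gen 0 \<otimes>\<^bsub>thompson_F\<^esub> thompson_gen i) u =
      (thompson_gen (Suc i) \<otimes>\<^bsub>thompson_F\<^esub> thompson_gen 0) u"
    using u by (simp only: thompson_F_mult_apply thompson_gen_in_carrier)
qed (simp_all add: thompson_gen_in_carrier)

lemma thompson_gen_generated:
  assumes S: "S \<subseteq> carrier thompson_F"
    and gen: "thompson_gen 0 \<in> generate thompson_F S" "thompson_gen 1 \<in> generate thompson_F S"
  shows "thompson_gen i \<in> generate thompson_F S"
proof (induction i)
  case (Suc i)
  show ?case
  proof (cases "i = 0")
    case False
    have "thompson_gen (Suc i) = thompson_gen 0 \<otimes>\<^bsub>thompson_F\<^esub> thompson_gen i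
        \<otimes>\<^bsub>thompson_F\<^esub> inv\<^bsub>thompson_F\<^esub> thompson_gen 0"
      using thompson.inv_solve_right[of "thompson_gen (Suc i)" "thompson_gen 0 \<otimes>\<^bsub>thompson_F\<^esub> thompson_gen i" "thompson_gen 0"]
        thompson_gen_conj[of i] False thompson_gen_in_carrier thompson.m_closed by blast
    then show ?thesis
      using Suc gen thompson.generate_m_inv_closed[OF S] generate.eng by metis
  qed (use gen in simp)
qed (rule gen)

section \<open>Partitions by powers of 1/2\<close>

text \<open>For positive \<open>n\<close> these are the end points of a partition into
  \<open>n\<close> standard dyadic intervals, the one whose binary tree always branches at the
  leftmost leaf.\<close>

definition vine :: "nat \<Rightarrow> real set" where
  "vine n = insert 0 ((\<lambda>k. 1 / 2 ^ k) ` {..<n})"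

lemma vine_Suc: "vine (Suc n) = insert (1 / 2 ^ n) (vine n)"
  unfolding vine_def by (simp add: lessThan_Suc insert_commute)

text \<open>The two cases are what the induction over partitions needs: halving the leftmost gap
  extends the vine, while halving any other gap calls for a generator.\<close>

lemma vine_gap:
  assumes "p \<in> vine n" "q \<in> vine n" "p < q" "{p<..<q} \<inter> vine n = {}"
  obtains "1 \<le> n" "p = 0" "q = 1 / 2 ^ (n - 1)"
  | i where "Suc i < n" "q = 1 / 2 ^ i" "p = 1 / 2 ^ Suc i"
proof -
  have "0 \<le> p" using assms(1) unfolding vine_def by auto
  then have "q \<noteq> 0" using assms(3) by simp
  then obtain i where i: "i < n" "q = 1 / 2 ^ i" using assms(2) unfolding vine_def by auto
  show thesis
  proof (cases "Suc i < n")
    case True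
    then have mem: "1 / 2 ^ Suc i \<in> vine n" unfolding vine_def by blast
    have "1 / 2 ^ Suc i < q" using i by (simp add: field_simps)
    then have ge: "1 / 2 ^ Suc i \<le> p" using assms(4) mem by (force simp: not_less)
    moreover have "(0::real) < 1 / 2 ^ Suc i" by simp
    ultimately have "p \<noteq> 0" by linarith
    then obtain j where j: "p = 1 / 2 ^ j" using assms(1) unfolding vine_def by auto
    have "(2::real) ^ j \<le> 2 ^ Suc i" using ge unfolding j by (simp add: field_simps)
    then have "j \<le> Suc i" by (rule power_le_imp_le_exp[rotated]) simp
    moreover have "(2::real) ^ i < 2 ^ j" using assms(3) unfolding i j by (simp add: field_simps)
    then have "i < j" by (rule power_less_imp_less_exp[rotated]) simp
    ultimately have "j = Suc i" by simp
    then show thesis using that(2) True i j by blast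
  next
    case False
    then have n: "n = Suc i" using i by simp
    have "p = 0"
    proof (rule ccontr)
      assume "p \<noteq> 0"
      then obtain j where j: "j < n" "p = 1 / 2 ^ j" using assms(1) unfolding vine_def by auto
      then have "(2::real) ^ j \<le> 2 ^ i" using n by (intro power_increasing) auto
      then have "q \<le> p" unfolding i j by (intro divide_left_mono) auto
      then show False using assms(3) by simp
    qed
    then show thesis using that(1) n i by simp
  qed
qed

text \<open>The added point is the midpoint of \<open>[1/2^(i+1), 1/2^i]\<close>. It moves to
  \<open>1/2^(i+1)\<close>, the points \<open>1/2^k\<close> with \<open>k > i\<close> are halved to
  make room for it, and those with \<open>k \<le> i\<close> stay.\<close>

lemma thompson_gen_vine:
  assumes "Suc i < n"
  shows "thompson_gen i ` insert (3 * (1 / 2 ^ i) / 4) (vine n) = vine (Suc n)"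
proof -
  have le: "(1::real) / 2 ^ k \<le> 1" for k :: nat by simp
  have anti: "(1::real) / 2 ^ l \<le> 1 / 2 ^ k" if "k \<le> l" for k l :: nat
    using that by (intro divide_left_mono power_increasing) auto
  have fix_: "thompson_gen i (1 / 2 ^ k) = 1 / 2 ^ k" if "k \<le> i" for k
    using that le anti by (intro thompson_gen_apply(4)) auto
  have shift: "thompson_gen i (1 / 2 ^ k) = 1 / 2 ^ Suc k" if "i < k" for k
  proof -
    have "thompson_gen i (1 / 2 ^ k) = 1 / 2 ^ k / 2"
      using anti[of "Suc i" k] that le by (intro thompson_gen_apply(1)) auto
    then show ?thesis by simp
  qed
  have mid: "thompson_gen i (3 * (1 / 2 ^ i) / 4) = 1 / 2 ^ Suc i"
  proof -
    define e :: real where "e = 1 / 2 ^ i"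
    have "0 < e" "e \<le> 1" unfolding e_def by simp_all
    then have "thompson_gen i (3 * e / 4) = 2 * (3 * e / 4) - e"
      using thompson_gen_apply(3)[of "3 * e / 4" i, folded e_def] by simp
    then show ?thesis unfolding e_def by simp
  qed
  have zero: "thompson_gen i 0 = 0" by (subst thompson_gen_apply(1)) auto
  have "{..<n} = {..i} \<union> {i<..<n}" using assms by auto
  then have "thompson_gen i ` insert (3 * (1 / 2 ^ i) / 4) (vine n) =
      {1 / 2 ^ Suc i, 0} \<union> (\<lambda>k. thompson_gen i (1 / 2 ^ k)) ` {..i}
        \<union> (\<lambda>k. thompson_gen i (1 / 2 ^ k)) ` {i<..<n}"
    unfolding vine_def by (simp only: image_insert image_Un image_image mid zero) blast
  also have "(\<lambda>k. thompson_gen i (1 / 2 ^ k)) ` {..i} = (\<lambda>k. 1 / 2 ^ k) ` {..i}"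
    using fix_ by (intro image_cong) auto
  also have "(\<lambda>k. thompson_gen i (1 / 2 ^ k)) ` {i<..<n} = (\<lambda>k. 1 / 2 ^ Suc k) ` {i<..<n}"
    using shift by (intro image_cong) auto
  also have "\<dots> = (\<lambda>k. 1 / 2 ^ k) ` Suc ` {i<..<n}" by (simp only: image_image)
  also have "Suc ` {i<..<n} = {Suc i<..<Suc n}"
    by (simp only: atLeastSucLessThan_greaterThanLessThan[symmetric] image_Suc_atLeastLessThan)
  also have "{1 / 2 ^ Suc i, 0} \<union> (\<lambda>k. 1 / 2 ^ k) ` {..i} \<union> (\<lambda>k. 1 / 2 ^ k) ` {Suc i<..<Suc n}
      = insert (0::real) ((\<lambda>k. 1 / 2 ^ k) ` (insert (Suc i) ({..i} \<union> {Suc i<..<Suc n})))"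
    by (simp only: image_insert image_Un) blast
  also have "insert (Suc i) ({..i} \<union> {Suc i<..<Suc n}) = {..<Suc n}" using assms by auto
  finally show ?thesis unfolding vine_def .
qed

section \<open>Standard dyadic partitions\<close>

definition standard_gap :: "real \<Rightarrow> real \<Rightarrow> bool" where
  "standard_gap a b \<longleftrightarrow> (\<exists>(i::nat) (m::nat). a = i / 2 ^ m \<and> b = (i + 1) / 2 ^ m)"

text \<open>A partition is encoded by its set of end points. These partitions are the leaf
  partitions of finite binary trees.\<close>

definition standard_partition :: "real set \<Rightarrow> bool" where
  "standard_partition Q \<longleftrightarrow> finite Q \<and> Q \<subseteq> {0..1} \<and> 0 \<in> Q \<and> 1 \<in> Q \<and>
     (\<forall>a\<in>Q. \<forall>b\<in>Q. a < b \<and> {a<..<b} \<inter> Q = {} \<longrightarrow> standard_gap a b)"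

lemma next_in_finite:
  assumes "finite (Q :: real set)" "c \<in> Q" "b < c"
  obtains d where "d \<in> Q" "b < d" "{b<..<d} \<inter> Q = {}"
proof -
  let ?A = "Q \<inter> {b<..}"
  have A: "finite ?A" "?A \<noteq> {}" using assms by auto
  have "Min ?A \<in> ?A" using A by (rule Min_in)
  moreover have "{b<..<Min ?A} \<inter> Q = {}"
    using Min_le[OF A(1)] by (force simp: not_less)
  ultimately show thesis using that by blast
qed

lemma prev_in_finite:
  assumes "finite (Q :: real set)" "c \<in> Q" "c < b"
  obtains d where "d \<in> Q" "d < b" "{d<..<b} \<inter> Q = {}"
proof -
  let ?A = "Q \<inter> {..<b}"
  have A: "finite ?A" "?A \<noteq> {}" using assms by auto
  have "Max ?A \<in> ?A" using A by (rule Max_in)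
  moreover have "{Max ?A<..<b} \<inter> Q = {}"
    using Max_ge[OF A(1)] by (force simp: not_less)
  ultimately show thesis using that by blast
qed

text \<open>A fraction with odd numerator is in lowest terms, so no smaller power of 2 can serve as
  its denominator.\<close>

lemma odd_dyadic_unique:
  assumes "odd p" "m' \<le> m" "real p / 2 ^ m = real q / 2 ^ m'"
  shows "m' = m \<and> q = p"
proof -
  obtain d where m: "m = m' + d" using assms(2) le_Suc_ex by blast
  have "real p = real (q * 2 ^ d)"
    using assms(3) unfolding m by (simp add: field_simps power_add)
  then have "p = q * 2 ^ d" by (simp only: of_nat_eq_iff)
  then show ?thesis using assms(1) unfolding m by (cases "d = 0") auto
qed

text \<open>The length of a standard gap is \<open>1 / 2^m'\<close>, so a lower bound on the length
  bounds the exponent. It is applied to the neighbour of a shortest gap.\<close>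

lemma standard_gap_refined_by:
  assumes "standard_gap a b" "1 / 2 ^ m \<le> b - a"
  obtains i m' :: nat where "m' \<le> m" "a = i / 2 ^ m'" "b = (i + 1) / 2 ^ m'"
proof -
  obtain i m' :: nat where i: "a = i / 2 ^ m'" "b = (i + 1) / 2 ^ m'"
    using assms(1) unfolding standard_gap_def by auto
  then have "1 / 2 ^ m \<le> (1::real) / 2 ^ m'"
    using assms(2) by (simp add: diff_divide_distrib[symmetric])
  then have "(2::real) ^ m' \<le> 2 ^ m" by (simp add: field_simps)
  then have "m' \<le> m" by (rule power_le_imp_le_exp[rotated]) simp
  then show thesis using that i by blast
qed

text \<open>An end point of a shortest gap is the midpoint of two sibling gaps.\<close>

lemma standard_partition_siblings:
  assumes Q: "standard_partition Q" and card: "2 < card Q"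
  obtains x y z where "x \<in> Q" "y \<in> Q" "z \<in> Q" "x < y" "y < z" "y = (x + z) / 2"
    "{x<..<y} \<inter> Q = {}" "{y<..<z} \<inter> Q = {}" "standard_gap x z"
proof -
  have fin: "finite Q" and sub: "Q \<subseteq> {0..1}" and ends: "0 \<in> Q" "1 \<in> Q"
    and gap: "\<And>a b. a \<in> Q \<Longrightarrow> b \<in> Q \<Longrightarrow> a < b \<Longrightarrow> {a<..<b} \<inter> Q = {} \<Longrightarrow> standard_gap a b"
    using Q unfolding standard_partition_def by auto
  define G where "G = {(a, b). a \<in> Q \<and> b \<in> Q \<and> a < b \<and> {a<..<b} \<inter> Q = {}}"
  have "G \<subseteq> Q \<times> Q" unfolding G_def by auto
  then have finG: "finite G" using fin finite_subset by blast
  obtain d where "d \<in> Q" "0 < d" "{0<..<d} \<inter> Q = {}"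
    using next_in_finite[OF fin ends(2), of 0] by auto
  then have "(0, d) \<in> G" unfolding G_def using ends by simp
  then have "G \<noteq> {}" by blast
  then obtain g where g: "g \<in> G" "\<And>h. h \<in> G \<Longrightarrow> snd g - fst g \<le> snd h - fst h"
    using arg_min_if_finite[OF finG, of "\<lambda>p. snd p - fst p"] by (metis not_less)
  define a b where "a = fst g" and "b = snd g"
  have ab: "(a, b) \<in> G" using g(1) unfolding a_def b_def by simp
  have min: "b - a \<le> q - p" if "(p, q) \<in> G" for p q
    using g(2)[OF that] unfolding a_def b_def by simp
  then have abQ: "a \<in> Q" "b \<in> Q" "a < b" "{a<..<b} \<inter> Q = {}" using ab unfolding G_def by auto
  obtain i m :: nat where i: "a = i / 2 ^ m" "b = (i + 1) / 2 ^ m"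
    using gap[OF abQ] unfolding standard_gap_def by auto
  have len: "b - a = 1 / 2 ^ m" using i by (simp add: diff_divide_distrib[symmetric])
  \<comment> \<open>A shortest gap of length 1 would leave only the points 0 and 1.\<close>
  have "m \<noteq> 0"
  proof
    assume "m = 0"
    then have "b - a = 1" using len by simp
    moreover have "0 \<le> a" "b \<le> 1" using sub abQ by auto
    ultimately have "a = 0" "b = 1" by auto
    have "Q \<subseteq> {0, 1}"
    proof
      fix q assume "q \<in> Q"
      then have "q \<notin> {0<..<1}" "0 \<le> q" "q \<le> 1"
        using abQ(4) sub unfolding \<open>a = 0\<close> \<open>b = 1\<close> by auto
      then show "q \<in> {0, 1}" by auto
    qed
    then have "card Q \<le> card {0, 1 :: real}" by (intro card_mono) auto
    then show False using card by simp
  qed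
  then obtain l where m: "m = Suc l" by (cases m) auto
  show thesis
  \<comment> \<open>The sibling lies on the side of the end point with odd numerator. The
    neighbouring gap there has exponent at most \<open>m\<close>, and by lowest terms exactly
    \<open>m\<close>; the union of the two gaps is the standard gap \<open>j\<close> at level
    \<open>l\<close>.\<close>
  proof (cases "even i")
    case True
    then obtain j where j: "i = 2 * j" by blast
    have "b \<noteq> 1"
    proof
      assume "b = 1"
      then have "real (i + 1) = real (2 ^ m)" using i by (simp add: field_simps)
      then have "i + 1 = 2 ^ m" by (simp only: of_nat_eq_iff)
      moreover have "even (2 ^ m :: nat)" using m by simp
      moreover have "odd (i + 1)" using True by simp
      ultimately show False by metis
    qed
    moreover have "b \<le> 1" using sub abQ(2) by auto
    ultimately have "b < 1" by simp
    then obtain c where c: "c \<in> Q" "b < c" "{b<..<c} \<inter> Q = {}"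
      using next_in_finite[OF fin ends(2)] by blast
    have "(b, c) \<in> G" unfolding G_def using abQ c by simp
    then have "1 / 2 ^ m \<le> c - b" using min len by metis
    then obtain i' m' :: nat where i': "m' \<le> m" "b = i' / 2 ^ m'" "c = (i' + 1) / 2 ^ m'"
      using standard_gap_refined_by[OF gap[OF abQ(2) c]] by blast
    have "m' = m \<and> i' = i + 1"
      using odd_dyadic_unique[of "i + 1" m' m i'] i i' True by simp
    then have c2: "c = (i + 2) / 2 ^ m" using i' by simp
    have "standard_gap a c"
      unfolding standard_gap_def using i c2 j m by (intro exI[of _ j] exI[of _ l]) (simp add: field_simps)
    moreover have "b = (a + c) / 2"
      unfolding i c2 by (simp add: add_divide_distrib)
    ultimately show thesis using that abQ c by blast
  next
    case False
    then obtain j where j: "i = 2 * j + 1" by (rule oddE)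
    have "0 < a" using i j by simp
    then obtain c where c: "c \<in> Q" "c < a" "{c<..<a} \<inter> Q = {}"
      using prev_in_finite[OF fin ends(1)] by blast
    have "(c, a) \<in> G" unfolding G_def using abQ c by simp
    then have "1 / 2 ^ m \<le> a - c" using min len by metis
    then obtain i' m' :: nat where i': "m' \<le> m" "c = i' / 2 ^ m'" "a = (i' + 1) / 2 ^ m'"
      using standard_gap_refined_by[OF gap[OF c(1) abQ(1) c(2,3)]] by blast
    have "m' = m \<and> i' + 1 = i"
      using odd_dyadic_unique[of i m' m "i' + 1"] i i' False by simp
    then have c2: "c = 2 * j / 2 ^ m" using i' j by simp
    have "standard_gap c b"
      unfolding standard_gap_def using i c2 j m by (intro exI[of _ j] exI[of _ l]) (simp add: field_simps)
    moreover have "a = (c + b) / 2"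
      unfolding i c2 j by (simp add: add_divide_distrib)
    ultimately show thesis using that abQ c by blast
  qed
qed

text \<open>The only new gap is the one between \<open>x\<close> and \<open>z\<close>; every other
  gap was already a gap of \<open>Q\<close>.\<close>

lemma standard_partition_remove_midpoint:
  assumes Q: "standard_partition Q"
    and xyz: "x \<in> Q" "z \<in> Q" "x < y" "y < z"
      "{x<..<y} \<inter> Q = {}" "{y<..<z} \<inter> Q = {}" "standard_gap x z"
  shows "standard_partition (Q - {y})"
proof -
  have sub: "Q \<subseteq> {0..1}" and ends: "0 \<in> Q" "1 \<in> Q"
    and gap: "\<And>a b. a \<in> Q \<Longrightarrow> b \<in> Q \<Longrightarrow> a < b \<Longrightarrow> {a<..<b} \<inter> Q = {} \<Longrightarrow> standard_gap a b"
    using Q unfolding standard_partition_def by auto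
  have "0 \<le> x" "z \<le> 1" using sub xyz(1,2) by auto
  then have "y \<noteq> 0" "y \<noteq> 1" using xyz(3,4) by simp_all
  moreover have "finite (Q - {y})" using Q unfolding standard_partition_def by simp
  moreover have "standard_gap p q"
    if pq: "p \<in> Q - {y}" "q \<in> Q - {y}" "p < q" "{p<..<q} \<inter> (Q - {y}) = {}" for p q
  proof (cases "y \<in> {p<..<q}")
    case True
    have "x \<in> Q - {y}" "z \<in> Q - {y}" using xyz(1-4) by simp_all
    then have "x \<notin> {p<..<q}" "z \<notin> {p<..<q}" using pq(4) by blast+
    moreover have "p \<notin> {x<..<y}" "q \<notin> {y<..<z}" using pq(1,2) xyz(5,6) by blast+
    ultimately have "p = x" "q = z" using True xyz(3,4) by simp_all
    then show ?thesis using xyz(7) by simp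
  next
    case False
    then have "{p<..<q} \<inter> Q = {}" using pq(4) by blast
    then show ?thesis using pq(1-3) gap by blast
  qed
  ultimately show ?thesis
    using ends sub unfolding standard_partition_def by blast
qed

text \<open>Induction on the number of parts. Merge two siblings and carry the coarser partition to
  a vine by \<open>h\<close>. Since \<open>h\<close> is affine on the merged gap, it maps the
  removed midpoint to the midpoint of a gap of the vine; if that is not the leftmost gap, a
  generator is applied afterwards. Affinity is part of the claim for this reason, and because it
  later determines the map.\<close>

lemma standard_partition_to_vine:
  assumes S: "S \<subseteq> carrier thompson_F"
    and gen: "thompson_gen 0 \<in> generate thompson_F S" "thompson_gen 1 \<in> generate thompson_F S"
    and Q: "standard_partition Q" "card Q = Suc (Suc n)"
  shows "\<exists>h\<in>generate thompson_F S. affine_on_gaps h Q \<and> h ` Q = vine (Suc n)"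
  using Q
proof (induction n arbitrary: Q)
  case 0
  then have Q: "finite Q" "{0, 1} \<subseteq> Q" unfolding standard_partition_def by auto
  have "{0, 1} = Q" by (rule card_subset_eq[OF Q]) (use 0 in simp)
  moreover have "affine_on_gaps \<one>\<^bsub>thompson_F\<^esub> Q"
    unfolding affine_on_gaps_def
    by (intro allI impI exI[of _ 0] exI[of _ 0]) (simp add: thompson_F_one_apply)
  moreover have "\<one>\<^bsub>thompson_F\<^esub> ` {0, 1} = vine (Suc 0)"
    by (auto simp: vine_def thompson_F_one_apply)
  ultimately show ?case using generate.one by blast
next
  case (Suc n)
  obtain x y z where xyz: "x \<in> Q" "y \<in> Q" "z \<in> Q" "x < y" "y < z" "y = (x + z) / 2"
    "{x<..<y} \<inter> Q = {}" "{y<..<z} \<inter> Q = {}" "standard_gap x z"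
    using standard_partition_siblings[OF Suc.prems(1)] Suc.prems(2) by auto
  have Q: "finite Q" "Q \<subseteq> {0..1}" using Suc.prems(1) unfolding standard_partition_def by auto
  define Q' where "Q' = Q - {y}"
  have Q': "standard_partition Q'" "card Q' = Suc (Suc n)" "Q = insert y Q'"
    unfolding Q'_def using standard_partition_remove_midpoint[OF Suc.prems(1) xyz(1,3-5,7-9)]
      xyz(2) Suc.prems(2) Q(1) by (simp_all add: insert_absorb)
  obtain h where h: "h \<in> generate thompson_F S" "affine_on_gaps h Q'" "h ` Q' = vine (Suc n)"
    using Suc.IH[OF Q'(1,2)] by blast
  have hF: "h \<in> carrier thompson_F" using h(1) thompson.generate_in_carrier[OF S] by blast
  have I: "x \<in> {0..1}" "y \<in> {0..1}" "z \<in> {0..1}" using xyz Q by auto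
  have gapQ': "{x<..<z} \<inter> Q' = {}"
  proof (rule ccontr)
    assume "{x<..<z} \<inter> Q' \<noteq> {}"
    then obtain q where "q \<in> Q" "q \<noteq> y" "x < q" "q < z" unfolding Q'_def by fastforce
    then have "q \<in> {x<..<y} \<union> {y<..<z}" by auto
    then show False using xyz(7,8) \<open>q \<in> Q\<close> by blast
  qed
  obtain k :: int and c where "\<And>u. u \<in> {x..z} \<Longrightarrow> h u = 2 powi k * u + c"
    using affine_on_gapsD[OF h(2) _ _ _ gapQ'] xyz I by auto
  then have hk: "h y = 2 powi k * y + c" "h x = 2 powi k * x + c" "h z = 2 powi k * z + c"
    using xyz(4,5) by auto
  have "2 * h y = 2 powi k * (2 * y) + 2 * c" unfolding hk(1) by simp
  also have "2 * y = x + z" using xyz(6) by simp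
  finally have "2 * h y = 2 powi k * (x + z) + 2 * c" .
  then have hy: "h y = (h x + h z) / 2" unfolding hk(2,3) by (simp add: algebra_simps)
  have mem: "x \<in> Q'" "z \<in> Q'" unfolding Q'_def using xyz by auto
  have "h x \<in> vine (Suc n)" "h z \<in> vine (Suc n)" using h(3) mem by auto
  moreover have "h x < h z" using thompson_F_less[OF hF I(1,3)] xyz by simp
  moreover have "{h x<..<h z} \<inter> vine (Suc n) = {}"
  proof (rule ccontr)
    assume "{h x<..<h z} \<inter> vine (Suc n) \<noteq> {}"
    then obtain q where q: "q \<in> Q'" "h x < h q" "h q < h z" unfolding h(3)[symmetric] by auto
    then have "q \<in> {0..1}" using Q Q'_def by auto
    then show False using q gapQ' thompson_F_less[OF hF I(1), of q] thompson_F_less[OF hF _ I(3), of q] by auto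
  qed
  ultimately show ?case
  proof (cases rule: vine_gap)
    case 1
    then have "h y = 1 / 2 ^ Suc n" unfolding hy by simp
    then have "h ` Q = vine (Suc (Suc n))"
      unfolding Q'(3) vine_Suc[of "Suc n"] h(3)[symmetric] by simp
    moreover have "affine_on_gaps h Q"
      using affine_on_gaps_superset[OF h(2)] Q'(3) by blast
    ultimately show ?thesis using h(1) by blast
  next
    case (2 i)
    have hy': "h y = 3 * (1 / 2 ^ i) / 4" unfolding hy 2 by (simp add: field_simps)
    have hQ: "h ` Q = insert (3 * (1 / 2 ^ i) / 4) (vine (Suc n))"
      unfolding Q'(3) h(3)[symmetric] hy'[symmetric] by simp
    let ?k = "thompson_gen i \<otimes>\<^bsub>thompson_F\<^esub> h"
    have kQ: "?k ` Q = vine (Suc (Suc n))"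
    proof -
      have "?k ` Q = thompson_gen i ` h ` Q"
        unfolding image_image using Q
        by (intro image_cong refl thompson_F_mult_apply[OF thompson_gen_in_carrier hF]) auto
      then show ?thesis unfolding hQ thompson_gen_vine[OF 2(1)] .
    qed
    note H = thompson_F_mapsD[OF hF[unfolded carrier_thompson_F]]
    have "affine_on_gaps (compose {0..1} (thompson_gen i) h) Q"
    proof (rule affine_on_gaps_compose[OF _ affine_on_gaps_thompson_gen _ H(3,2)])
      show "affine_on_gaps h Q" using affine_on_gaps_superset[OF h(2)] Q'(3) by blast
      \<comment> \<open>The breakpoints of the generator are exactly the images of \<open>x\<close>,
        \<open>y\<close> and \<open>z\<close>, so the composite stays affine on the gaps of
        \<open>Q\<close>.\<close>
      have C: "{1 / 2 ^ i / 2, 3 * (1 / 2 ^ i) / 4, 1 / 2 ^ i} = h ` {x, y, z}"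
        using 2 hy' by (simp add: mult.commute)
      have inj: "inj_on h {0..1}" using H(4) by (simp add: Bij_def bij_betw_def)
      show "{u \<in> {0..1}. h u \<in> {1 / 2 ^ i / 2, 3 * (1 / 2 ^ i) / 4, 1 / 2 ^ i}} \<subseteq> Q"
        unfolding C
      proof
        fix u assume "u \<in> {u \<in> {0..1}. h u \<in> h ` {x, y, z}}"
        then obtain v where v: "u \<in> {0..1}" "v \<in> {x, y, z}" "h u = h v" by blast
        then have "v \<in> {0..1}" using I by blast
        then have "u = v" using inj_onD[OF inj v(3,1)] by blast
        then show "u \<in> Q" using v(2) xyz(1-3) by blast
      qed
    qed
    moreover have "compose {0..1} (thompson_gen i) h = ?k"
      using hF thompson_gen_in_carrier[of i] thompson_F_mapsD(4)
      unfolding carrier_thompson_F by (simp add: thompson_F_def BijGroup_def)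
    moreover have "?k \<in> generate thompson_F S"
      using thompson_gen_generated[OF S gen] h(1) by (rule generate.eng)
    ultimately show ?thesis using kQ by metis
  qed
qed

section \<open>Uniform grids and their images under F\<close>

definition dyadic_grid :: "nat \<Rightarrow> real set" where
  "dyadic_grid N = (\<lambda>i. real i / 2 ^ N) ` {..2 ^ N}"

lemma dyadic_grid_mono:
  assumes "M \<le> N" shows "dyadic_grid M \<subseteq> dyadic_grid N"
proof
  fix x assume "x \<in> dyadic_grid M"
  then obtain i where i: "i \<le> 2 ^ M" "x = real i / 2 ^ M" unfolding dyadic_grid_def by auto
  obtain d where N: "N = M + d" using assms le_Suc_ex by blast
  have "x = real (i * 2 ^ d) / 2 ^ N" unfolding i N by (simp add: power_add)
  moreover have "i * 2 ^ d \<le> 2 ^ N" unfolding N power_add using i(1) by simp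
  ultimately show "x \<in> dyadic_grid N" unfolding dyadic_grid_def by blast
qed

lemma finite_dyadics_subset_grid:
  assumes "finite B" "B \<subseteq> dyadic_rationals \<inter> {0..1}"
  shows "\<exists>N. B \<subseteq> dyadic_grid N"
  using assms
proof induction
  case (insert x B)
  then obtain M where M: "B \<subseteq> dyadic_grid M" by auto
  have "x \<in> dyadics" using insert.prems dyadic_rationals_nonneg by simp
  then obtain i n :: nat where x: "x = real i / 2 ^ n" unfolding dyadics_def by auto
  have "real i / 2 ^ n \<le> 1" using insert.prems x by simp
  then have "real i \<le> real (2 ^ n)" by (simp add: field_simps)
  then have "i \<le> 2 ^ n" by (simp only: of_nat_le_iff)
  then have "x \<in> dyadic_grid n" using x unfolding dyadic_grid_def by blast
  then show ?case
    using M dyadic_grid_mono[of M "max M n"] dyadic_grid_mono[of n "max M n"] by auto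
qed simp

lemma dyadic_grid_unit_interval: "dyadic_grid N \<subseteq> {0..1}"
proof
  fix x assume "x \<in> dyadic_grid N"
  then obtain i :: nat where i: "i \<le> 2 ^ N" "x = real i / 2 ^ N" unfolding dyadic_grid_def by auto
  have "real i \<le> real (2 ^ N)" using i(1) by (simp only: of_nat_le_iff)
  then show "x \<in> {0..1}" unfolding i by simp
qed

lemma dyadic_grid_gap:
  assumes "a \<in> dyadic_grid N" "b \<in> dyadic_grid N" "a < b" "{a<..<b} \<inter> dyadic_grid N = {}"
  obtains i where "i < 2 ^ N" "a = real i / 2 ^ N" "b = (real i + 1) / 2 ^ N"
proof -
  obtain i j where ij: "i \<le> 2 ^ N" "a = real i / 2 ^ N" "j \<le> 2 ^ N" "b = real j / 2 ^ N"
    using assms(1,2) unfolding dyadic_grid_def by auto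
  have lt: "i < j" using assms(3) unfolding ij by (simp add: divide_less_cancel)
  have "\<not> Suc i < j"
  proof
    assume *: "Suc i < j"
    then have "real (Suc i) / 2 ^ N \<in> dyadic_grid N"
      using ij(3) unfolding dyadic_grid_def by (intro imageI) simp
    moreover have "real (Suc i) / 2 ^ N \<in> {a<..<b}"
      using * unfolding ij by (simp add: divide_less_cancel)
    ultimately show False using assms(4) by blast
  qed
  then have "j = Suc i" using lt by simp
  then show thesis using that[of i] ij lt by (simp add: add.commute)
qed

lemma standard_partition_grid: "standard_partition (dyadic_grid N)"
  unfolding standard_partition_def
proof (intro conjI ballI impI)
  show "finite (dyadic_grid N)" unfolding dyadic_grid_def by simp
  show "0 \<in> dyadic_grid N" unfolding dyadic_grid_def by (rule image_eqI[of _ _ 0]) simp_all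
  show "1 \<in> dyadic_grid N" unfolding dyadic_grid_def by (rule image_eqI[of _ _ "2 ^ N"]) simp_all
  fix a b assume "a \<in> dyadic_grid N" "b \<in> dyadic_grid N" "a < b \<and> {a<..<b} \<inter> dyadic_grid N = {}"
  then obtain i where "a = real i / 2 ^ N" "b = (real i + 1) / 2 ^ N"
    using dyadic_grid_gap by metis
  then show "standard_gap a b" unfolding standard_gap_def
    by (intro exI[of _ i] exI[of _ N]) (simp add: add.commute)
qed (rule dyadic_grid_unit_interval)

text \<open>With \<open>m = N - k\<close> the grid step is scaled to \<open>1 / 2^m\<close>, and for
  large \<open>N\<close> the intercept is an integer \<open>w\<close> over \<open>2^m\<close>; cell
  \<open>i\<close> becomes cell \<open>i + w\<close> at level \<open>m\<close>. Nonnegativity is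
  required because standard gaps have natural numerators.\<close>

lemma standard_gap_affine_image:
  assumes c: "c \<in> dyadic_rationals"
  shows "\<exists>n0. \<forall>N\<ge>n0. \<forall>i. 0 \<le> 2 powi k * (real i / 2 ^ N) + c \<longrightarrow>
    standard_gap (2 powi k * (real i / 2 ^ N) + c) (2 powi k * ((real i + 1) / 2 ^ N) + c)"
proof -
  obtain z :: int and n :: nat where z: "c = z / 2 ^ n"
    using c unfolding dyadic_rationals_def by blast
  show ?thesis
  proof (intro exI[of _ "n + nat \<bar>k\<bar>"] allI impI)
    fix N i :: nat
    assume N: "n + nat \<bar>k\<bar> \<le> N" and pos: "0 \<le> 2 powi k * (real i / 2 ^ N) + c"
    define m where "m = nat (int N - k)"
    have m: "int m = int N - k" "n \<le> m" using N unfolding m_def by auto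
    have "2 powi k / 2 ^ N = (2::real) powi (k - int N)" by (simp add: power_int_diff)
    also have "k - int N = - int m" using m by simp
    finally have scale: "2 powi k / 2 ^ N = (1::real) / 2 ^ m" by (simp add: power_int_minus divide_inverse)
    define w where "w = z * 2 ^ (m - n)"
    have "2 ^ m = (2::real) ^ n * 2 ^ (m - n)" using m(2) by (simp add: power_add[symmetric])
    then have c': "c = w / 2 ^ m" unfolding z w_def by simp
    have val: "2 powi k * (r / 2 ^ N) + c = (r + w) / 2 ^ m" for r :: real
    proof -
      have "2 powi k * (r / 2 ^ N) = r * (2 powi k / 2 ^ N)" by simp
      then show ?thesis unfolding scale c' by (simp add: add_divide_distrib)
    qed
    have "0 \<le> (real i + w) / 2 ^ m * 2 ^ m"
      using pos unfolding val by (intro mult_nonneg_nonneg) simp_all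
    then have "0 \<le> real i + w" by simp
    then have "0 \<le> int i + w" by linarith
    then have iw: "real i + w = real (nat (int i + w))" by simp
    show "standard_gap (2 powi k * (real i / 2 ^ N) + c) (2 powi k * ((real i + 1) / 2 ^ N) + c)"
      unfolding standard_gap_def val
      by (intro exI[of _ "nat (int i + w)"] exI[of _ m]) (simp add: iw[symmetric])
  qed
qed

lemma grid_subinterval:
  assumes "M \<le> N" "i < 2 ^ N"
  obtains j where "j < 2 ^ M" "real j / 2 ^ M \<le> real i / 2 ^ N"
    "(real i + 1) / 2 ^ N \<le> (real j + 1) / 2 ^ M"
proof -
  obtain d where N: "N = M + d" using assms le_Suc_ex by blast
  \<comment> \<open>Cell \<open>i\<close> of the finer grid lies in the coarse cell obtained by
    dropping the last \<open>d\<close> binary digits.\<close>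
  define j where "j = i div 2 ^ d"
  have "j < 2 ^ M" unfolding j_def using assms(2) unfolding N
    by (simp add: less_mult_imp_div_less power_add)
  moreover have "j * 2 ^ d \<le> i" unfolding j_def by simp
  then have "real (j * 2 ^ d) \<le> real i" by (simp only: of_nat_le_iff)
  then have "real j / 2 ^ M \<le> real i / 2 ^ N" unfolding N by (simp add: field_simps power_add)
  moreover have "i < (j + 1) * 2 ^ d"
    unfolding j_def using dividend_less_div_times[of "2 ^ d" i] by (simp add: algebra_simps)
  then have "i + 1 \<le> (j + 1) * 2 ^ d" by simp
  then have "real (i + 1) \<le> real ((j + 1) * 2 ^ d)" by (simp only: of_nat_le_iff)
  then have "(real i + 1) / 2 ^ N \<le> ((real j + 1) * 2 ^ d) / 2 ^ N"
    by (intro divide_right_mono) (simp_all add: algebra_simps)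
  then have "(real i + 1) / 2 ^ N \<le> (real j + 1) / 2 ^ M"
    unfolding N by (simp add: power_add)
  ultimately show thesis using that by blast
qed

text \<open>Choose a grid whose cells carry affine pieces of \<open>f\<close>. On each cell all
  sufficiently fine subcells are mapped to standard gaps, and finitely many cells have a common
  threshold.\<close>

lemma thompson_F_standard_partition:
  assumes f: "f \<in> carrier thompson_F"
  obtains N where "affine_on_gaps f (dyadic_grid N)" "standard_partition (f ` dyadic_grid N)"
proof -
  have fm: "f \<in> thompson_F_maps" using f unfolding carrier_thompson_F .
  note F = thompson_F_mapsD[OF fm]
  obtain B where B: "finite B" "B \<subseteq> dyadic_rationals \<inter> {0..1}" "affine_on_gaps f B"
    using thompson_F_maps_breakpoints[OF fm] .
  obtain M where "B \<subseteq> dyadic_grid M" using finite_dyadics_subset_grid[OF B(1,2)] by blast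
  then have affM: "affine_on_gaps f (dyadic_grid M)" using affine_on_gaps_superset[OF B(3)] by blast
  have cell: "\<exists>n0. \<forall>N\<ge>n0. \<forall>i. real j / 2 ^ M \<le> real i / 2 ^ N \<and>
      (real i + 1) / 2 ^ N \<le> (real j + 1) / 2 ^ M \<longrightarrow>
      standard_gap (f (real i / 2 ^ N)) (f ((real i + 1) / 2 ^ N))" if j: "j < 2 ^ M" for j :: nat
  proof -
    define a b where "a = real j / 2 ^ M" and "b = (real j + 1) / 2 ^ M"
    have mem: "a \<in> dyadic_grid M"
      unfolding a_def dyadic_grid_def using j by (intro imageI) simp
    have "real (j + 1) / 2 ^ M \<in> dyadic_grid M"
      unfolding dyadic_grid_def using j by (intro imageI) simp
    then have "b \<in> dyadic_grid M" unfolding b_def by (simp add: add.commute)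
    then have ab: "0 \<le> a" "a < b" "b \<le> 1" "a \<in> {0..1}"
      using mem dyadic_grid_unit_interval[of M] unfolding a_def b_def by (auto simp: divide_less_cancel)
    have "{a<..<b} \<inter> dyadic_grid M = {}"
    proof (rule ccontr)
      assume "{a<..<b} \<inter> dyadic_grid M \<noteq> {}"
      then obtain l where "a < real l / 2 ^ M" "real l / 2 ^ M < b"
        unfolding dyadic_grid_def by auto
      then have "real j < real l" "real l < real (Suc j)"
        unfolding a_def b_def by (simp_all add: divide_less_cancel)
      then have "j < l" "l < Suc j" by (simp_all only: of_nat_less_iff)
      then show False by simp
    qed
    then obtain k :: int and c where kc: "\<And>x. x \<in> {a..b} \<Longrightarrow> f x = 2 powi k * x + c"
      using affine_on_gapsD[OF affM ab(1-3)] by blast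
    have aD: "a \<in> dyadic_rationals" unfolding a_def by (rule dyadic_rationalsI[of _ "int j" M]) simp
    then have "f a \<in> dyadic_rationals" using thompson_F_maps_dyadic[OF fm] ab(4) by blast
    \<comment> \<open>The intercept is dyadic because \<open>f\<close> maps the dyadic point
      \<open>a\<close> to a dyadic point.\<close>
    moreover have "c = f a - 2 powi k * a" using kc[of a] ab by simp
    ultimately have "c \<in> dyadic_rationals"
      using aD dyadic_rationals_powi dyadic_rationals_mult dyadic_rationals_diff by metis
    then obtain n0 where n0: "\<And>N i. n0 \<le> N \<Longrightarrow> 0 \<le> 2 powi k * (real i / 2 ^ N) + c \<Longrightarrow>
        standard_gap (2 powi k * (real i / 2 ^ N) + c) (2 powi k * ((real i + 1) / 2 ^ N) + c)"
      using standard_gap_affine_image by blast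
    show ?thesis
    proof (intro exI[of _ n0] allI impI, elim conjE)
      fix N i :: nat
      assume N: "n0 \<le> N" and le: "real j / 2 ^ M \<le> real i / 2 ^ N"
        "(real i + 1) / 2 ^ N \<le> (real j + 1) / 2 ^ M"
      have lt: "real i / 2 ^ N < (real i + 1) / 2 ^ N" by (simp add: divide_less_cancel)
      have "a \<le> real i / 2 ^ N" "(real i + 1) / 2 ^ N \<le> b" using le unfolding a_def b_def .
      then have in_ab: "real i / 2 ^ N \<in> {a..b}" "(real i + 1) / 2 ^ N \<in> {a..b}" using lt by auto
      moreover have "{a..b} \<subseteq> {0..1}" using ab(1,3) by auto
      ultimately have "real i / 2 ^ N \<in> {0..1}" by blast
      then have "0 \<le> f (real i / 2 ^ N)" using thompson_F_range[OF f] by simp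
      then show "standard_gap (f (real i / 2 ^ N)) (f ((real i + 1) / 2 ^ N))"
        using n0[OF N] unfolding kc[OF in_ab(1)] kc[OF in_ab(2)] by blast
    qed
  qed
  have "\<forall>j\<in>{..<2 ^ M}. eventually (\<lambda>N. \<forall>i. real j / 2 ^ M \<le> real i / 2 ^ N \<and>
      (real i + 1) / 2 ^ N \<le> (real j + 1) / 2 ^ M \<longrightarrow>
      standard_gap (f (real i / 2 ^ N)) (f ((real i + 1) / 2 ^ N))) sequentially"
    unfolding eventually_sequentially using cell by blast
  then have "eventually (\<lambda>N. \<forall>j\<in>{..<2 ^ M}. \<forall>i. real j / 2 ^ M \<le> real i / 2 ^ N \<and>
      (real i + 1) / 2 ^ N \<le> (real j + 1) / 2 ^ M \<longrightarrow>
      standard_gap (f (real i / 2 ^ N)) (f ((real i + 1) / 2 ^ N))) sequentially"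
    by (intro eventually_ball_finite) simp_all
  then obtain n0 where n0: "\<And>N j i. n0 \<le> N \<Longrightarrow> j < 2 ^ M \<Longrightarrow> real j / 2 ^ M \<le> real i / 2 ^ N \<Longrightarrow>
      (real i + 1) / 2 ^ N \<le> (real j + 1) / 2 ^ M \<Longrightarrow>
      standard_gap (f (real i / 2 ^ N)) (f ((real i + 1) / 2 ^ N))"
    unfolding eventually_sequentially by (metis lessThan_iff)
  define N where "N = max n0 M"
  have N: "n0 \<le> N" "M \<le> N" unfolding N_def by simp_all
  have grid: "standard_partition (dyadic_grid N)" by (rule standard_partition_grid)
  have "standard_partition (f ` dyadic_grid N)"
    unfolding standard_partition_def
  proof (intro conjI ballI impI)
    show "finite (f ` dyadic_grid N)" using grid unfolding standard_partition_def by simp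
    show "f ` dyadic_grid N \<subseteq> {0..1}" using dyadic_grid_unit_interval[of N] F(2) by blast
    have "0 \<in> dyadic_grid N" "1 \<in> dyadic_grid N" using grid unfolding standard_partition_def by simp_all
    then show "0 \<in> f ` dyadic_grid N" "1 \<in> f ` dyadic_grid N"
      using F(5,6) by (metis imageI)+
    fix p q assume pq: "p \<in> f ` dyadic_grid N" "q \<in> f ` dyadic_grid N"
      "p < q \<and> {p<..<q} \<inter> f ` dyadic_grid N = {}"
    then obtain a b where ab: "a \<in> dyadic_grid N" "b \<in> dyadic_grid N" "p = f a" "q = f b" by blast
    have I: "x \<in> {0..1}" if "x \<in> dyadic_grid N" for x using that dyadic_grid_unit_interval by blast
    have less: "f x < f y \<longleftrightarrow> x < y" if "x \<in> dyadic_grid N" "y \<in> dyadic_grid N" for x y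
      by (intro thompson_F_less[OF f] I that)
    have "a < b" using pq(3) less[OF ab(1,2)] unfolding ab(3,4) by simp
    moreover have "{a<..<b} \<inter> dyadic_grid N = {}"
    proof (rule ccontr)
      assume "{a<..<b} \<inter> dyadic_grid N \<noteq> {}"
      then obtain x where x: "x \<in> dyadic_grid N" "a < x" "x < b" by fastforce
      then have "f x \<in> {p<..<q} \<inter> f ` dyadic_grid N"
        unfolding ab(3,4) using less[OF ab(1) x(1)] less[OF x(1) ab(2)] by simp
      then show False using pq(3) by blast
    qed
    ultimately obtain i where i: "i < 2 ^ N" "a = real i / 2 ^ N" "b = (real i + 1) / 2 ^ N"
      using dyadic_grid_gap[OF ab(1,2)] by blast
    obtain j where "j < 2 ^ M" "real j / 2 ^ M \<le> real i / 2 ^ N"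
      "(real i + 1) / 2 ^ N \<le> (real j + 1) / 2 ^ M"
      using grid_subinterval[OF N(2) i(1)] .
    then show "standard_gap p q" unfolding ab(3,4) i(2,3) by (rule n0[OF N(1)])
  qed
  moreover have "affine_on_gaps f (dyadic_grid N)"
    by (rule affine_on_gaps_superset[OF affM dyadic_grid_mono[OF N(2)]])
  ultimately show thesis using that by blast
qed

section \<open>Uniqueness of the map and generation by two elements\<close>

text \<open>At the least point \<open>m\<close> of disagreement, the smaller of the two values must
  be attained by the other map below \<open>m\<close>; there both maps agree, which contradicts
  strict monotonicity.\<close>

lemma strict_mono_same_image:
  fixes f g :: "real \<Rightarrow> real"
  assumes P: "finite P" and f: "strict_mono_on P f" and g: "strict_mono_on P g" and im: "f ` P = g ` P"
    and x: "x \<in> P"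
  shows "f x = g x"
proof (rule ccontr)
  assume ne: "f x \<noteq> g x"
  let ?D = "{x \<in> P. f x \<noteq> g x}"
  have D: "finite ?D" "?D \<noteq> {}" using P x ne by auto
  define m where "m = Min ?D"
  have m: "m \<in> P" "f m \<noteq> g m" using Min_in[OF D] unfolding m_def by auto
  have below: "f y = g y" if "y \<in> P" "y < m" for y
    using Min_le[OF D(1), of y] that unfolding m_def[symmetric] by auto
  show False
  proof (cases "f m < g m")
    case True
    obtain y where y: "y \<in> P" "f m = g y" using im m(1) by (metis imageE imageI)
    then have "y < m" using True strict_mono_on_less[OF g y(1) m(1)] by simp
    then show False
      using below[OF y(1)] y(2) strict_mono_on_less[OF f y(1) m(1)] by simp
  next
    case False
    then have lt: "g m < f m" using m(2) by simp
    obtain y where y: "y \<in> P" "g m = f y" using im m(1) by (metis imageE imageI)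
    then have "y < m" using lt strict_mono_on_less[OF f y(1) m(1)] by simp
    then show False
      using below[OF y(1)] y(2) strict_mono_on_less[OF g y(1) m(1)] by simp
  qed
qed

text \<open>Two affine maps that agree at both end points of a gap have equal slope and
  intercept.\<close>

lemma affine_on_gaps_unique:
  assumes f: "affine_on_gaps f P" and g: "affine_on_gaps g P"
    and P: "finite P" "0 \<in> P" "1 \<in> P" "P \<subseteq> {0..1}"
    and eq: "\<And>x. x \<in> P \<Longrightarrow> f x = g x" and x: "x \<in> {0..1}"
  shows "f x = g x"
proof (cases "x \<in> P")
  case False
  have "x \<noteq> 0" "x \<noteq> 1" using False P(2,3) by auto
  then have "0 < x" "x < 1" using x by auto
  then obtain p q where p: "p \<in> P" "p < x" "{p<..<x} \<inter> P = {}"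
    and q: "q \<in> P" "x < q" "{x<..<q} \<inter> P = {}"
    using prev_in_finite[OF P(1,2)] next_in_finite[OF P(1,3)] by metis
  have "{p<..<q} \<subseteq> {p<..<x} \<union> {x} \<union> {x<..<q}" by auto
  then have gap: "{p<..<q} \<inter> P = {}" using p(3) q(3) False by blast
  have pq: "0 \<le> p" "p < q" "q \<le> 1" using p q P(4) by auto
  obtain k :: int and c where kc: "\<And>y. y \<in> {p..q} \<Longrightarrow> f y = 2 powi k * y + c"
    using affine_on_gapsD[OF f pq gap] by blast
  obtain l :: int and d where ld: "\<And>y. y \<in> {p..q} \<Longrightarrow> g y = 2 powi l * y + d"
    using affine_on_gapsD[OF g pq gap] by blast
  have "2 powi k * p + c = 2 powi l * p + d" "2 powi k * q + c = 2 powi l * q + d"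
    using eq[OF p(1)] eq[OF q(1)] kc[of p] kc[of q] ld[of p] ld[of q] pq by simp_all
  then have *: "((2::real) powi k - 2 powi l) * (q - p) = 0" "2 powi k * p + c = 2 powi l * p + d"
    by (simp_all add: algebra_simps)
  then have "(2::real) powi k = 2 powi l" using pq by simp
  moreover from this have "c = d" using *(2) by simp
  ultimately show ?thesis using kc[of x] ld[of x] p q by simp
qed (rule eq)

lemma generate_thompson_F:
  assumes S: "S \<subseteq> carrier thompson_F"
    and gen: "thompson_gen 0 \<in> generate thompson_F S" "thompson_gen 1 \<in> generate thompson_F S"
  shows "generate thompson_F S = carrier thompson_F"
proof
  show "generate thompson_F S \<subseteq> carrier thompson_F" using thompson.generate_incl[OF S] .
  show "carrier thompson_F \<subseteq> generate thompson_F S"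
  proof
    fix f assume f: "f \<in> carrier thompson_F"
    obtain N where affP: "affine_on_gaps f (dyadic_grid N)"
      and std: "standard_partition (f ` dyadic_grid N)"
      using thompson_F_standard_partition[OF f] .
    define P where "P = dyadic_grid N"
    have P: "finite P" "P \<subseteq> {0..1}" "0 \<in> P" "1 \<in> P"
      using standard_partition_grid[of N] unfolding P_def standard_partition_def by simp_all
    note F = thompson_F_mapsD[OF f[unfolded carrier_thompson_F]]
    have inj: "inj_on f {0..1}" using F(4) by (simp add: Bij_def bij_betw_def)
    have "card {0, 1 :: real} \<le> card P" using P by (intro card_mono) simp_all
    then obtain n where n: "card P = Suc (Suc n)"
      by (metis Suc_le_D card_2_iff numeral_2_eq_2 zero_neq_one Suc_le_mono)
    have n': "card (f ` P) = Suc (Suc n)"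
      using n card_image[OF inj_on_subset[OF inj P(2)]] by simp
    obtain h1 where h1: "h1 \<in> generate thompson_F S" "affine_on_gaps h1 P" "h1 ` P = vine (Suc n)"
      using standard_partition_to_vine[OF S gen standard_partition_grid n[unfolded P_def]]
      unfolding P_def by blast
    obtain h2 where h2: "h2 \<in> generate thompson_F S" "affine_on_gaps h2 (f ` P)"
      "h2 ` f ` P = vine (Suc n)"
      using standard_partition_to_vine[OF S gen std n'[unfolded P_def]] unfolding P_def by blast
    have hF: "h1 \<in> carrier thompson_F" "h2 \<in> carrier thompson_F"
      using h1(1) h2(1) thompson.generate_in_carrier[OF S] by blast+
    define k where "k = h2 \<otimes>\<^bsub>thompson_F\<^esub> f"
    have kF: "k \<in> carrier thompson_F" unfolding k_def using hF f by simp
    have k: "k = compose {0..1} h2 f"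
      using hF(2) f thompson_F_mapsD(4)
      unfolding k_def carrier_thompson_F by (simp add: thompson_F_def BijGroup_def)
    have kx: "k x = h2 (f x)" if "x \<in> {0..1}" for x
      unfolding k using that by (simp add: compose_def)
    have "{x \<in> {0..1}. f x \<in> f ` P} \<subseteq> P"
      using inj P(2) by (auto dest: inj_onD)
    then have affk: "affine_on_gaps k P"
      unfolding k by (intro affine_on_gaps_compose[OF affP[folded P_def] h2(2) _ F(3,2)])
    have kP: "k ` P = h1 ` P"
      unfolding h1(3) h2(3)[symmetric] image_image using kx P(2) by (intro image_cong) auto
    have mono: "strict_mono_on P h" if "h \<in> carrier thompson_F" for h
      using thompson_F_mapsD(3)[OF that[unfolded carrier_thompson_F]] P(2)
      by (rule monotone_on_subset)
    have "k = h1"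
    proof (rule thompson_F_eqI[OF kF hF(1)])
      show "k x = h1 x" if "x \<in> {0..1}" for x
        by (rule affine_on_gaps_unique[OF affk h1(2) P(1,3,4,2) _ that])
          (rule strict_mono_same_image[OF P(1) mono[OF kF] mono[OF hF(1)] kP])
    qed
    then have "f = inv\<^bsub>thompson_F\<^esub> h2 \<otimes>\<^bsub>thompson_F\<^esub> h1"
      using thompson.inv_solve_left[OF f hF(2,1)] unfolding k_def by simp
    then show "f \<in> generate thompson_F S"
      using generate.eng[OF thompson.generate_m_inv_closed[OF S h2(1)] h1(1)] by simp
  qed
qed

section \<open>One-endedness of F\<close>

theorem proposition21:
  shows "has_one_end thompson_F"
proof -
  define f0 f1 b where "f0 = thompson_gen 0" and "f1 = thompson_gen 1" and "b = thompson_gen 2"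
  have F: "f0 \<in> carrier thompson_F" "f1 \<in> carrier thompson_F" "b \<in> carrier thompson_F"
    unfolding f0_def f1_def b_def by (rule thompson_gen_in_carrier)+
  \<comment> \<open>\<open>f0\<close> and \<open>f1\<close> both halve \<open>[0, 1/4]\<close>, so
    \<open>w\<close> is the identity there.\<close>
  define w where "w = inv\<^bsub>thompson_F\<^esub> f1 \<otimes>\<^bsub>thompson_F\<^esub> f0"
  \<comment> \<open>\<open>f0\<close> maps \<open>[0, 1/2]\<close> into \<open>[0, 1/4]\<close>,
    which \<open>w\<close> fixes; conjugation thus doubles the fixed interval.\<close>
  define a where "a = inv\<^bsub>thompson_F\<^esub> f0 \<otimes>\<^bsub>thompson_F\<^esub> (w \<otimes>\<^bsub>thompson_F\<^esub> f0)"
  have wF: "w \<in> carrier thompson_F" unfolding w_def using F by simp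
  have aF: "a \<in> carrier thompson_F" unfolding a_def using F wF by simp
  have f0_w: "f0 = f1 \<otimes>\<^bsub>thompson_F\<^esub> w"
    unfolding w_def using F by (simp add: thompson.m_assoc[symmetric])
  have f0_low: "f0 x = x / 2" if "0 \<le> x" "x \<le> 1 / 2" for x
    unfolding f0_def using that by (intro thompson_gen_apply(1)) simp_all
  have f1_low: "f1 x = x / 2" if "0 \<le> x" "x \<le> 1 / 4" for x
    unfolding f1_def using that by (intro thompson_gen_apply(1)) simp_all
  have f1_fix: "f1 \<in> thompson_F_fixer {1 / 2..1}"
    unfolding thompson_F_fixer_def using F(2) thompson_gen_apply(4)[of _ 1] by (simp add: f1_def)
  have b_fix: "b \<in> thompson_F_fixer {1 / 4..1}"
    unfolding thompson_F_fixer_def using F(3) thompson_gen_apply(4)[of _ 2] by (simp add: b_def)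
  then have b_fix': "b \<in> thompson_F_fixer {1 / 2..1}"
    unfolding thompson_F_fixer_def by simp
  have w_fix: "w \<in> thompson_F_fixer {0..1 / 4}"
    unfolding thompson_F_fixer_def
  proof (intro CollectI conjI ballI wF)
    fix x :: real assume x: "x \<in> {0..1 / 4}"
    then have "w x = (inv\<^bsub>thompson_F\<^esub> f1) (f0 x)"
      unfolding w_def using F by (intro thompson_F_mult_apply) simp_all
    also have "f0 x = f1 x" using f0_low[of x] f1_low[of x] x by simp
    finally show "w x = x" using thompson_F_inv_apply[OF F(2), of x] x by simp
  qed
  have a_fix: "a \<in> thompson_F_fixer {0..1 / 2}"
    unfolding thompson_F_fixer_def
  proof (intro CollectI conjI ballI aF)
    fix x :: real assume x: "x \<in> {0..1 / 2}"
    then have x1: "x \<in> {0..1}" by simp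
    have "a x = (inv\<^bsub>thompson_F\<^esub> f0) ((w \<otimes>\<^bsub>thompson_F\<^esub> f0) x)"
      unfolding a_def using F wF x1 by (intro thompson_F_mult_apply) simp_all
    also have "(w \<otimes>\<^bsub>thompson_F\<^esub> f0) x = w (f0 x)" by (rule thompson_F_mult_apply[OF wF F(1) x1])
    also have "w (f0 x) = f0 x"
      using w_fix f0_low[of x] x unfolding thompson_F_fixer_def by simp
    finally show "a x = x" using thompson_F_inv_apply[OF F(1) x1] by simp
  qed
  have ne_f1: "f1 \<noteq> \<one>\<^bsub>thompson_F\<^esub>"
    using f1_low[of "1 / 4"] thompson_F_one_apply[of "1 / 4"] by auto
  have ne_b: "b \<noteq> \<one>\<^bsub>thompson_F\<^esub>"
    using thompson_gen_apply(1)[of "1 / 8" 2] thompson_F_one_apply[of "1 / 8"] unfolding b_def by auto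
  have ne_w: "w \<noteq> \<one>\<^bsub>thompson_F\<^esub>"
  proof
    assume "w = \<one>\<^bsub>thompson_F\<^esub>"
    then have "f0 = f1" using f0_w F by simp
    moreover have "f1 (1 / 2) = 1 / 2" using f1_fix unfolding thompson_F_fixer_def by simp
    ultimately show False using f0_low[of "1 / 2"] by simp
  qed
  have ne_a: "a \<noteq> \<one>\<^bsub>thompson_F\<^esub>"
  proof
    assume "a = \<one>\<^bsub>thompson_F\<^esub>"
    then have "w \<otimes>\<^bsub>thompson_F\<^esub> f0 = f0 \<otimes>\<^bsub>thompson_F\<^esub> \<one>\<^bsub>thompson_F\<^esub>"
      unfolding a_def using F wF thompson.inv_solve_left'[of "\<one>\<^bsub>thompson_F\<^esub>" f0 "w \<otimes>\<^bsub>thompson_F\<^esub> f0"] by simp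
    then have "w \<otimes>\<^bsub>thompson_F\<^esub> f0 = \<one>\<^bsub>thompson_F\<^esub> \<otimes>\<^bsub>thompson_F\<^esub> f0" using F by simp
    then show False using ne_w thompson.right_cancel[OF F(1) wF thompson.one_closed] by simp
  qed
  \<comment> \<open>The supports are separated by the point 1/2 in the first two pairs and by 1/4 in
    the last.\<close>
  have ind: "independent thompson_F f1 a" "independent thompson_F b a" "independent thompson_F b w"
    using thompson_F_independent[OF f1_fix ne_f1 a_fix ne_a]
      thompson_F_independent[OF b_fix' ne_b a_fix ne_a]
      thompson_F_independent[OF b_fix ne_b w_fix ne_w] by simp_all
  define T where "T = {f1, a, b, w}"
  have TF: "T \<subseteq> carrier thompson_F" unfolding T_def using F aF wF by simp
  have "f1 \<in> generate thompson_F T" "w \<in> generate thompson_F T"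
    unfolding T_def by (simp_all add: generate.incl)
  then have "f0 \<in> generate thompson_F T" "f1 \<in> generate thompson_F T"
    unfolding f0_w by (simp_all add: generate.eng)
  then have gen: "generate thompson_F T = carrier thompson_F"
    unfolding f0_def f1_def by (rule generate_thompson_F[OF TF])
  let ?R = "{(s, t). s \<in> T \<and> t \<in> T \<and> independent thompson_F s t}"
  have "sym ?R"
  proof (rule symI, clarify)
    fix s t assume "s \<in> T" "t \<in> T" "independent thompson_F s t"
    then show "independent thompson_F t s"
      using group.independent_sym[OF thompson.is_group] TF by blast
  qed
  then have sym: "(t, s) \<in> ?R\<^sup>+" if "(s, t) \<in> ?R\<^sup>+" for s t
    using that symD[OF sym_trancl] by fastforce
  have R: "(f1, a) \<in> ?R\<^sup>+" "(b, a) \<in> ?R\<^sup>+" "(b, w) \<in> ?R\<^sup>+"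
    using ind unfolding T_def by (simp_all add: r_into_trancl)
  \<comment> \<open>The hub of the chain is \<open>a\<close>: it reaches itself through
    \<open>b\<close>, and \<open>w\<close> reaches it through \<open>b\<close>.\<close>
  then have "(a, a) \<in> ?R\<^sup>+" "(w, a) \<in> ?R\<^sup>+"
    using trancl_trans[OF sym[OF R(2)] R(2)] trancl_trans[OF sym[OF R(3)] R(2)] by simp_all
  with R(1,2) have to_a: "(s, a) \<in> ?R\<^sup>+" if "s \<in> T" for s
    using that unfolding T_def by (elim insertE) simp_all
  have "(s, t) \<in> ?R\<^sup>+" if "s \<in> T" "t \<in> T" for s t
    by (rule trancl_trans[OF to_a[OF that(1)] sym[OF to_a[OF that(2)]]])
  then show ?thesis
    by (intro group.has_one_end_if_independence_connected[OF thompson.is_group _ TF gen]) (simp_all add: T_def)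
qed

end
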